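(* Every Hilbert space satisfies the Mazur--Ulam property. Every rank one JBW$^*$-triple satisfies the Mazur--Ulam property.
   Context: $S(X)$ denotes the unit sphere of a Banach space $X$. A Banach space $X$ satisfies the Mazur--Ulam property if for any Banach space $Y$, every surjective isometry $\Delta: S(X)\to S(Y)$ admits an extension to a surjective real linear isometry from $X$ onto $Y$. A JB$^*$-triple is a complex Banach space $E$ with a continuous triple product $\{\cdot,\cdot,\cdot\}:E\times E\times E\to E$ which is symmetric and linear in the first and third variables, conjugate linear in the second variable, and satisfies, writing $L(a,b)x=\{a,b,x\}$: (a) $L(a,b)L(x,y)=L(x,y)L(a,b)+L(L(a,b)x,y)-L(x,L(b,a)y)$ for all $a,b,x,y\in E$; (b) $L(a,a)$ is a hermitian operator with non-negative spectrum for all $a\in E$; (c) $\|\{a,a,a\}\|=\|a\|^3$ for all $a\in E$. A JBW$^*$-triple is a JB$^*$-triple which is also a dual Banach space. Elements $a,b$ are orthogonal, $a\perp b$, if $L(a,b)=0$. A subset $S\subseteq E$ is orthogonal if $0\notin S$ and $x\perp y$ for all $x\neq y$ in $S$. The rank of $E$ is the minimal cardinal number $r$ satisfying $\mathrm{card}(S)\le r$ for every orthogonal subset $S$ of $E$. *)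

theory Defs
  imports "HOL-Analysis.Analysis"
begin

unbundle cardinal_syntax

section \<open>The Mazur--Ulam property\<close>

text \<open>
  HOL cannot quantify over types inside a formula, so the property is stated relative to a target
  space \<open>'y\<close>; \<open>'x\<close> has the Mazur--Ulam property iff this holds for an arbitrary (schematic)
  type \<open>'y\<close>.  Linearity is over the reals throughout, so \<open>'x\<close> and \<open>'y\<close> may be real or complex.
\<close>

definition mazur_ulam_property :: "'x::banach itself \<Rightarrow> 'y::banach itself \<Rightarrow> bool" where
  "mazur_ulam_property X Y \<longleftrightarrow>
    (\<forall>\<Delta> :: 'x \<Rightarrow> 'y.
      \<Delta> ` sphere 0 1 = sphere 0 1 \<and>
      (\<forall>x\<in>sphere 0 1. \<forall>y\<in>sphere 0 1. dist (\<Delta> x) (\<Delta> y) = dist x y) \<longrightarrow>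
      (\<exists>T :: 'x \<Rightarrow> 'y. linear T \<and> surj T \<and> (\<forall>x y. dist (T x) (T y) = dist x y) \<and>
        (\<forall>x\<in>sphere 0 1. T x = \<Delta> x)))"


section \<open>Complex Banach and Hilbert spaces\<close>

class complex_banach = banach +
  fixes scaleC :: "complex \<Rightarrow> 'a \<Rightarrow> 'a" (infixr \<open>*\<^sub>C\<close> 75)
  assumes scaleC_add_right: "c *\<^sub>C (x + y) = c *\<^sub>C x + c *\<^sub>C y"
    and scaleC_add_left: "(c + d) *\<^sub>C x = c *\<^sub>C x + d *\<^sub>C x"
    and scaleC_scaleC: "c *\<^sub>C d *\<^sub>C x = (c * d) *\<^sub>C x"
    and scaleR_scaleC: "r *\<^sub>R x = complex_of_real r *\<^sub>C x"
    and norm_scaleC: "norm (c *\<^sub>C x) = cmod c * norm x"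

text \<open>
  The inner product is linear in the first variable; its positivity is part of
  \<open>cinner_self\<close>.
\<close>

class complex_hilbert = complex_banach +
  fixes cinner :: "'a \<Rightarrow> 'a \<Rightarrow> complex"
  assumes cinner_commute: "cinner x y = cnj (cinner y x)"
    and cinner_add_left: "cinner (x + y) z = cinner x z + cinner y z"
    and cinner_scaleC_left: "cinner (c *\<^sub>C x) y = c * cinner x y"
    and cinner_self: "cinner x x = complex_of_real ((norm x)\<^sup>2)"

instantiation complex :: complex_hilbert
begin

definition "c *\<^sub>C (z::complex) = c * z"
definition "cinner (z::complex) w = z * cnj w"

instance
  by standard
    (auto simp: scaleC_complex_def cinner_complex_def algebra_simps scaleR_conv_of_real
      norm_mult complex_norm_square[symmetric])

end

definition bounded_clinear :: "('a::complex_banach \<Rightarrow> 'b::complex_banach) \<Rightarrow> bool" where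
  "bounded_clinear T \<longleftrightarrow> bounded_linear T \<and> (\<forall>c x. T (c *\<^sub>C x) = c *\<^sub>C T x)"

text \<open>The spectrum is taken in the algebra of bounded complex-linear operators.\<close>

definition op_spectrum :: "('a::complex_banach \<Rightarrow> 'a) \<Rightarrow> complex set" where
  "op_spectrum T =
    {c. \<not> (\<exists>S. bounded_clinear S \<and>
              (\<forall>x. S (T x - c *\<^sub>C x) = x) \<and> (\<forall>x. T (S x) - c *\<^sub>C S x = x))}"

definition op_exp :: "('a::banach \<Rightarrow> 'a) \<Rightarrow> 'a \<Rightarrow> 'a" where
  "op_exp T x = (\<Sum>n. (T ^^ n) x /\<^sub>R fact n)"

text \<open>A bounded operator \<open>T\<close> is hermitian if \<open>exp (itT)\<close> is an isometry for every real \<open>t\<close>.\<close>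

definition hermitian_op :: "('a::complex_banach \<Rightarrow> 'a) \<Rightarrow> bool" where
  "hermitian_op T \<longleftrightarrow>
    bounded_clinear T \<and>
    (\<forall>t x. norm (op_exp (\<lambda>y. (\<i> * complex_of_real t) *\<^sub>C T y) x) = norm x)"


section \<open>JB*-triples and JBW*-triples\<close>

text \<open>The operator \<open>L(a,b)\<close> is the partial application \<open>tp a b\<close> of the triple product.\<close>

locale jb_star_triple =
  fixes tp :: "'e::complex_banach \<Rightarrow> 'e \<Rightarrow> 'e \<Rightarrow> 'e"
  assumes continuous_tp: "continuous_on UNIV (\<lambda>(a, b, c). tp a b c)"
    and tp_commute: "tp a b c = tp c b a"
    and tp_add_left: "tp (a + a') b c = tp a b c + tp a' b c"
    and tp_scaleC_left: "tp (r *\<^sub>C a) b c = r *\<^sub>C tp a b c"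
    and tp_add_right: "tp a b (c + c') = tp a b c + tp a b c'"
    and tp_scaleC_right: "tp a b (r *\<^sub>C c) = r *\<^sub>C tp a b c"
    and tp_add_middle: "tp a (b + b') c = tp a b c + tp a b' c"
    and tp_scaleC_middle: "tp a (r *\<^sub>C b) c = cnj r *\<^sub>C tp a b c"
    and jordan_identity:
      "tp a b (tp x y z) = tp x y (tp a b z) + tp (tp a b x) y z - tp x (tp b a y) z"
    and hermitian: "hermitian_op (tp a a)"
    and spectrum_nonneg: "op_spectrum (tp a a) \<subseteq> complex_of_real ` {0..}"
    and norm_cube: "norm (tp a a a) = norm a ^ 3"

text \<open>
  The type of bounded real-linear maps \<open>'p \<Rightarrow>\<^sub>L complex\<close> contains the complex dual of \<open>'p\<close> as the
  set of complex-linear functionals.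
\<close>

definition complex_dual :: "('p::complex_banach \<Rightarrow>\<^sub>L complex) set" where
  "complex_dual = {f. \<forall>c x. blinfun_apply f (c *\<^sub>C x) = c * blinfun_apply f x}"

definition is_dual_of :: "'e::complex_banach itself \<Rightarrow> 'p::complex_banach itself \<Rightarrow> bool" where
  "is_dual_of E P \<longleftrightarrow>
    (\<exists>J :: 'e \<Rightarrow> 'p \<Rightarrow>\<^sub>L complex.
      linear J \<and>
      (\<forall>c x p. blinfun_apply (J (c *\<^sub>C x)) p = c * blinfun_apply (J x) p) \<and>
      (\<forall>x. norm (J x) = norm x) \<and>
      range J = complex_dual)"

text \<open>
  The predual \<open>'p\<close> is a type parameter; as it occurs only in hypotheses, a schematic \<open>'p\<close>
  expresses that some predual exists.
\<close>

definition jbw_star_triple ::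
    "('e::complex_banach \<Rightarrow> 'e \<Rightarrow> 'e \<Rightarrow> 'e) \<Rightarrow> 'p::complex_banach itself \<Rightarrow> bool" where
  "jbw_star_triple tp P \<longleftrightarrow> jb_star_triple tp \<and> is_dual_of TYPE('e) P"

definition triple_orthogonal :: "('e::zero \<Rightarrow> 'e \<Rightarrow> 'e \<Rightarrow> 'e) \<Rightarrow> 'e \<Rightarrow> 'e \<Rightarrow> bool" where
  "triple_orthogonal tp a b \<longleftrightarrow> tp a b = (\<lambda>x. 0)"

definition orthogonal_subset :: "('e::zero \<Rightarrow> 'e \<Rightarrow> 'e \<Rightarrow> 'e) \<Rightarrow> 'e set \<Rightarrow> bool" where
  "orthogonal_subset tp S \<longleftrightarrow>
    0 \<notin> S \<and> (\<forall>x\<in>S. \<forall>y\<in>S. x \<noteq> y \<longrightarrow> triple_orthogonal tp x y)"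

text \<open>
  Cardinals are well-orders on \<open>'e\<close>, up to \<open>=o\<close>.  This loses nothing: every cardinal bounded by
  that of \<open>'e\<close> is represented on \<open>'e\<close>, and \<open>|UNIV :: 'e set|\<close> already is an upper bound.
\<close>

definition is_triple_rank :: "('e::zero \<Rightarrow> 'e \<Rightarrow> 'e \<Rightarrow> 'e) \<Rightarrow> 'e rel \<Rightarrow> bool" where
  "is_triple_rank tp r \<longleftrightarrow>
    Card_order r \<and> (\<forall>S. orthogonal_subset tp S \<longrightarrow> |S| \<le>o r) \<and>
    (\<forall>r' :: 'e rel. Card_order r' \<and> (\<forall>S. orthogonal_subset tp S \<longrightarrow> |S| \<le>o r') \<longrightarrow> r \<le>o r')"

definition triple_rank_one :: "('e::zero \<Rightarrow> 'e \<Rightarrow> 'e \<Rightarrow> 'e) \<Rightarrow> bool" where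
  "triple_rank_one tp \<longleftrightarrow> is_triple_rank tp |{0}|"

end

theory Submission
  imports Defs
begin

text \<open>
  All three assertions come from one criterion: a Banach space whose norm satisfies the
  parallelogram law has the Mazur--Ulam property (\<open>parallelogram_imp_mazur_ulam\<close>).

  Let \<open>\<Delta>\<close> be a surjective isometry from the unit sphere of such a space onto that of \<open>Y\<close>. By
  strict convexity \<open>-x\<close> is the only unit vector at distance 2 from \<open>x\<close>, so \<open>\<Delta>\<close> is odd. Hence
  \<open>\<parallel>u + v\<parallel>\<^sup>2 + \<parallel>u - v\<parallel>\<^sup>2 = 4\<close> for all unit vectors \<open>u\<close>, \<open>v\<close> of \<open>Y\<close>. By a theorem of Day this
  rhombus law forces every plane of \<open>Y\<close> to be Euclidean: an ellipse of maximal area inscribed in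
  the unit disc touches the unit circle on two different lines, the rhombus law makes the set of
  touching directions closed under bisection, and so ellipse and disc agree. Consequently
  \<open>\<parallel>a u + b v\<parallel>\<close> depends only on \<open>a\<close>, \<open>b\<close> and \<open>\<parallel>u - v\<parallel>\<close> (\<open>rhombus_law_norm_combination\<close>), which
  makes the homogeneous extension of \<open>\<Delta>\<close> an isometry; it preserves midpoints because these are
  metrically unique in the source, and so it is linear.

  It remains to show that the norm of a rank one JB*-triple satisfies the parallelogram law. Fix
  \<open>x\<close> and let \<open>L = L(x,x)\<close>. Because \<open>L\<close> is hermitian, the operators \<open>U = exp (itL)\<close> are
  isometries, and \<open>cos (tL + c)\<close>, \<open>sin (tL + c)\<close> are operators of norm at most 1. The square
  root \<open>R = \<bar>sin (tL + c)\<bar>\<close> of \<open>1 - cos (tL + c)\<^sup>2\<close> is a norm limit of polynomials in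
  \<open>cos (tL + c)\<^sup>2\<close>. On the closed span of the odd powers \<open>L\<^sup>n x\<close> all these operators can be
  moved from the first to the second variable of the triple product, so \<open>(R + S) x\<close> and
  \<open>(R - S) x\<close>, where \<open>S = sin (tL + c)\<close>, are orthogonal. Rank one makes one of them vanish for
  every \<open>c\<close>; they are interchanged by \<open>c \<mapsto> c + \<pi>\<close>, so by connectedness both vanish for some \<open>c\<close>,
  whence \<open>sin (tL + c) x = 0\<close>. Letting \<open>t\<close> tend to 0 shows that \<open>x\<close> is an eigenvector of \<open>L\<close>,
  and the remaining axioms give \<open>{x,x,x} = \<parallel>x\<parallel>\<^sup>2 x\<close> (\<open>cube_eq_norm_square\<close>).

  Finally, if all cubes have this form, then every unit vector \<open>e\<close> is a tripotent. Comparing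
  coefficients in the cube of \<open>e + t y\<close> shows that the Peirce spaces of \<open>e\<close> are \<open>E\<^sub>2 = \<complex> e\<close>,
  \<open>E\<^sub>0 = 0\<close>, and that \<open>\<parallel>a e + y\<parallel>\<^sup>2 = \<bar>a\<bar>\<^sup>2 + \<parallel>y\<parallel>\<^sup>2\<close> for \<open>y \<in> E\<^sub>1\<close>; the parallelogram law
  follows.
\<close>

section \<open>Norms satisfying the rhombus law\<close>

text \<open>
  The ellipse with conjugate semi-axes \<open>p\<close> and \<open>q\<close>, the image of the unit disc under
  \<open>(c, s) \<mapsto> c p + s q\<close>, lies in the unit disc of the norm \<open>z \<mapsto> \<parallel>\<phi> z\<parallel>\<close>. The complex plane only
  serves as a model of \<open>\<real>\<^sup>2\<close>; \<open>\<phi>\<close> will be real linear and injective.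
\<close>

definition inscribed :: "(complex \<Rightarrow> 'a::real_normed_vector) \<Rightarrow> complex \<Rightarrow> complex \<Rightarrow> bool" where
  "inscribed \<phi> p q \<longleftrightarrow> (\<forall>c s::real. (norm (\<phi> (c *\<^sub>R p + s *\<^sub>R q)))\<^sup>2 \<le> c\<^sup>2 + s\<^sup>2)"

text \<open>
  The signed area of the parallelogram spanned by \<open>p\<close> and \<open>q\<close>, which is the area of the ellipse
  up to the factor \<open>\<pi>\<close>.
\<close>

definition area :: "complex \<Rightarrow> complex \<Rightarrow> real" where
  "area p q = Re p * Im q - Im p * Re q"

lemma inscribedD: "inscribed \<phi> p q \<Longrightarrow> (norm (\<phi> (c *\<^sub>R p + s *\<^sub>R q)))\<^sup>2 \<le> c\<^sup>2 + s\<^sup>2"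
  by (simp add: inscribed_def)

lemma inj_linear_bounded_below:
  fixes \<phi> :: "complex \<Rightarrow> 'a::real_normed_vector"
  assumes "bounded_linear \<phi>" and "\<And>z. \<phi> z = 0 \<Longrightarrow> z = 0"
  obtains B where "B > 0" "\<And>z. B * norm z \<le> norm (\<phi> z)"
proof -
  interpret \<phi>: bounded_linear \<phi> by fact
  have "\<exists>w\<in>sphere 0 1. \<forall>z\<in>sphere 0 1. norm (\<phi> w) \<le> norm (\<phi> z)"
    by (rule continuous_attains_inf) (auto intro!: continuous_intros \<phi>.continuous_on)
  then obtain w where w: "norm w = 1" "\<And>z. norm z = 1 \<Longrightarrow> norm (\<phi> w) \<le> norm (\<phi> z)"
    by auto
  have "norm (\<phi> w) > 0" using w(1) assms(2)[of w] by auto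
  moreover have "norm (\<phi> w) * norm z \<le> norm (\<phi> z)" for z
  proof (cases "z = 0")
    case False
    then have "norm (\<phi> w) \<le> norm (\<phi> (z /\<^sub>R norm z))" by (intro w(2)) auto
    also have "\<dots> = norm (\<phi> z) / norm z"
      by (simp add: \<phi>.scaleR divide_inverse mult.commute)
    finally show ?thesis using False by (simp add: field_simps)
  qed (simp add: \<phi>.zero)
  ultimately show ?thesis using that by blast
qed

lemma ex_maximal_inscribed:
  fixes \<phi> :: "complex \<Rightarrow> 'a::real_normed_vector"
  assumes lin: "bounded_linear \<phi>" and inj: "\<And>z. \<phi> z = 0 \<Longrightarrow> z = 0"
  obtains p q where "inscribed \<phi> p q" "area p q > 0"
    "\<And>p' q'. inscribed \<phi> p' q' \<Longrightarrow> area p' q' \<le> area p q"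
proof -
  interpret \<phi>: bounded_linear \<phi> by fact
  obtain B where B: "B > 0" "\<And>z. B * norm z \<le> norm (\<phi> z)"
    using inj_linear_bounded_below[OF assms] by blast
  obtain M where M: "M > 0" "\<And>z. norm (\<phi> z) \<le> norm z * M"
    using \<phi>.pos_bounded by blast
  define K where "K = {pq. inscribed \<phi> (fst pq) (snd pq)}"
  have cont: "continuous_on UNIV \<phi>" using lin by (rule linear_continuous_on)
  have "closed K"
    unfolding K_def inscribed_def
    by (intro closed_Collect_all closed_Collect_le continuous_intros
        continuous_on_compose2[OF cont]) auto
  moreover have "bounded K"
  proof -
    have "norm (fst pq) \<le> 1 / B \<and> norm (snd pq) \<le> 1 / B" if "pq \<in> K" for pq
    proof -
      have "(norm (\<phi> (fst pq)))\<^sup>2 \<le> 1" "(norm (\<phi> (snd pq)))\<^sup>2 \<le> 1"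
        using that inscribedD[of \<phi> "fst pq" "snd pq" 1 0] inscribedD[of \<phi> "fst pq" "snd pq" 0 1]
        by (auto simp: K_def)
      then have "norm (\<phi> (fst pq)) \<le> 1" "norm (\<phi> (snd pq)) \<le> 1"
        by (auto simp: power_le_one_iff abs_square_le_1)
      then show ?thesis
        using B(1) B(2)[of "fst pq"] B(2)[of "snd pq"] by (simp add: field_simps)
    qed
    then have "K \<subseteq> cball 0 (1/B) \<times> cball 0 (1/B)" by (auto simp: mem_Times_iff)
    then show ?thesis by (rule bounded_subset[rotated]) (intro bounded_Times bounded_cball)
  qed
  ultimately have comp: "compact K" by (simp add: compact_eq_bounded_closed)
  define d where "d = 1 / M"
  have d: "d > 0" using M by (simp add: d_def)
  have start: "inscribed \<phi> (of_real d) (of_real d * \<i>)"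
    unfolding inscribed_def
  proof (intro allI)
    fix c s :: real
    have "norm (\<phi> (c *\<^sub>R of_real d + s *\<^sub>R (of_real d * \<i>))) \<le> norm (Complex (d * c) (d * s)) * M"
      using M(2)[of "Complex (d * c) (d * s)"]
        by (simp add: scaleR_conv_of_real complex_eq_iff Complex_eq algebra_simps)
    then have "(norm (\<phi> (c *\<^sub>R of_real d + s *\<^sub>R (of_real d * \<i>))))\<^sup>2 \<le> (norm (Complex (d * c) (d * s)) * M)\<^sup>2"
      by (rule power_mono) simp
    also have "\<dots> = c\<^sup>2 + s\<^sup>2"
      using M(1) by (simp add: cmod_def power_mult_distrib d_def field_simps)
    finally show "(norm (\<phi> (c *\<^sub>R of_real d + s *\<^sub>R (of_real d * \<i>))))\<^sup>2 \<le> c\<^sup>2 + s\<^sup>2" .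
  qed
  have "\<exists>w\<in>K. \<forall>z\<in>K. area (fst z) (snd z) \<le> area (fst w) (snd w)"
    using start
    by (intro continuous_attains_sup comp) (auto simp: area_def K_def intro!: continuous_intros)
  then obtain w where w: "w \<in> K" "\<And>z. z \<in> K \<Longrightarrow> area (fst z) (snd z) \<le> area (fst w) (snd w)"
    by blast
  have "area (of_real d) (of_real d * \<i>) \<le> area (fst w) (snd w)"
    using w(2)[of "(of_real d, of_real d * \<i>)"] start by (simp add: K_def)
  then have "area (fst w) (snd w) > 0" using d by (simp add: area_def) (smt (verit) mult_pos_pos)
  with w that[of "fst w" "snd w"] show ?thesis by (auto simp: K_def)
qed

text \<open>
  For every point of a maximal inscribed ellipse there is a touching point off the line through
  it: otherwise, with the given point as first semi-axis, shrinking this semi-axis by \<open>1 - \<epsilon>\<close>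
  and stretching the conjugate one by \<open>1 + 2 \<epsilon>\<close> would give a larger inscribed ellipse.
\<close>

lemma maximal_inscribed_touches:
  fixes \<phi> :: "complex \<Rightarrow> 'a::real_normed_vector"
  assumes lin: "bounded_linear \<phi>" and ins: "inscribed \<phi> p q" and pos: "area p q > 0"
    and max: "\<And>p' q'. inscribed \<phi> p' q' \<Longrightarrow> area p' q' \<le> area p q"
    and unit: "a\<^sup>2 + b\<^sup>2 = (1::real)"
  obtains c s :: real where "c\<^sup>2 + s\<^sup>2 = 1" "norm (\<phi> (c *\<^sub>R p + s *\<^sub>R q)) = 1" "a * s - b * c \<noteq> 0"
proof (rule ccontr)
  assume no: "\<not> thesis"
  note touch = that
  interpret \<phi>: bounded_linear \<phi> by fact
  \<comment> \<open>Rotate the parametrization so that the given direction becomes the first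
      semi-axis.\<close>
  define p0 where "p0 = a *\<^sub>R p + b *\<^sub>R q"
  define q0 where "q0 = (-b) *\<^sub>R p + a *\<^sub>R q"
  have rot: "c *\<^sub>R p0 + s *\<^sub>R q0 = (c * a - s * b) *\<^sub>R p + (c * b + s * a) *\<^sub>R q" for c s
    by (simp add: p0_def q0_def algebra_simps)
  have rot_norm: "(c * a - s * b)\<^sup>2 + (c * b + s * a)\<^sup>2 = c\<^sup>2 + s\<^sup>2" for c s :: real
  proof -
    have "(c * a - s * b)\<^sup>2 + (c * b + s * a)\<^sup>2 = (c\<^sup>2 + s\<^sup>2) * (a\<^sup>2 + b\<^sup>2)" by algebra
    then show ?thesis by (simp add: unit)
  qed
  have ins0: "(norm (\<phi> (c *\<^sub>R p0 + s *\<^sub>R q0)))\<^sup>2 \<le> c\<^sup>2 + s\<^sup>2" for c s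
    unfolding rot using inscribedD[OF ins] rot_norm by metis
  have strict: "(norm (\<phi> (c *\<^sub>R p0 + s *\<^sub>R q0)))\<^sup>2 < 1" if "c\<^sup>2 + s\<^sup>2 = 1" "s \<noteq> 0" for c s :: real
  proof -
    have "norm (\<phi> (c *\<^sub>R p0 + s *\<^sub>R q0)) \<noteq> 1"
    proof
      assume *: "norm (\<phi> (c *\<^sub>R p0 + s *\<^sub>R q0)) = 1"
      have "a * (c * b + s * a) - b * (c * a - s * b) = s * (a\<^sup>2 + b\<^sup>2)" by algebra
      then have "a * (c * b + s * a) - b * (c * a - s * b) \<noteq> 0" using that unit by simp
      then show False
        using no touch[of "c * a - s * b" "c * b + s * a"] that(1) * rot_norm[of c s] unfolding rot by simp
    qed
    with ins0[of c s] that show ?thesis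
      by (metis less_eq_real_def norm_ge_zero one_power2 power2_eq_imp_eq zero_le_one)
  qed
  \<comment> \<open>Away from the first semi-axis the ellipse stays uniformly inside the unit disc.
      The bound 1/5 on the squared sine is small enough for the stretching estimate near
      the axis.\<close>
  define T where "T = {z::complex. norm z = 1 \<and> (Im z)\<^sup>2 \<ge> 1/5}"
  have "compact T"
  proof -
    have "T = sphere 0 1 \<inter> {z. (Im z)\<^sup>2 \<ge> 1/5}" by (auto simp: T_def)
    moreover have "closed {z::complex. (Im z)\<^sup>2 \<ge> 1/5}"
      by (intro closed_Collect_le continuous_intros)
    ultimately show ?thesis by (simp add: compact_Int_closed)
  qed
  moreover have "\<i> \<in> T" by (simp add: T_def)
  ultimately have "\<exists>w\<in>T. \<forall>z\<in>T. (norm (\<phi> (Re z *\<^sub>R p0 + Im z *\<^sub>R q0)))\<^sup>2 \<le> (norm (\<phi> (Re w *\<^sub>R p0 + Im w *\<^sub>R q0)))\<^sup>2"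
    by (intro continuous_attains_sup) (auto intro!: continuous_intros \<phi>.continuous_on)
  then obtain w where w: "w \<in> T"
    "\<And>z. z \<in> T \<Longrightarrow> (norm (\<phi> (Re z *\<^sub>R p0 + Im z *\<^sub>R q0)))\<^sup>2 \<le> (norm (\<phi> (Re w *\<^sub>R p0 + Im w *\<^sub>R q0)))\<^sup>2"
    by blast
  define \<eta> where "\<eta> = 1 - (norm (\<phi> (Re w *\<^sub>R p0 + Im w *\<^sub>R q0)))\<^sup>2"
  have \<eta>: "0 < \<eta>"
    using w(1) strict[of "Re w" "Im w"] by (cases "Im w = 0") (auto simp: \<eta>_def T_def cmod_def)
  have far: "(norm (\<phi> (c *\<^sub>R p0 + s *\<^sub>R q0)))\<^sup>2 \<le> (1 - \<eta>) * (c\<^sup>2 + s\<^sup>2)" if "5 * s\<^sup>2 \<ge> c\<^sup>2 + s\<^sup>2" for c s :: real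
  proof (cases "c\<^sup>2 + s\<^sup>2 = 0")
    case True
    then show ?thesis by (simp add: \<phi>.zero)
  next
    case False
    define r where "r = sqrt (c\<^sup>2 + s\<^sup>2)"
    have r: "r > 0" "r\<^sup>2 = c\<^sup>2 + s\<^sup>2"
      using False sum_power2_ge_zero[of c s] by (auto simp: r_def less_le)
    have "(c/r)\<^sup>2 + (s/r)\<^sup>2 = 1"
      using False by (simp only: power_divide add_divide_distrib[symmetric] r(2)) simp
    moreover have "1/5 * r\<^sup>2 \<le> s\<^sup>2" using r that by simp
    then have "1/5 \<le> (s/r)\<^sup>2" using r(1) by (simp add: power_divide pos_le_divide_eq)
    ultimately have "Complex (c/r) (s/r) \<in> T" by (simp add: T_def cmod_def)
    from w(2)[OF this]
    have "(norm (\<phi> ((c/r) *\<^sub>R p0 + (s/r) *\<^sub>R q0)))\<^sup>2 \<le> 1 - \<eta>" by (simp add: \<eta>_def)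
    moreover have "(c/r) *\<^sub>R p0 + (s/r) *\<^sub>R q0 = (c *\<^sub>R p0 + s *\<^sub>R q0) /\<^sub>R r"
      by (simp add: scaleR_add_right divide_inverse mult.commute)
    ultimately have "(norm (\<phi> (c *\<^sub>R p0 + s *\<^sub>R q0)) / r)\<^sup>2 \<le> 1 - \<eta>"
      using r by (simp add: \<phi>.scaleR divide_inverse mult.commute)
    then show ?thesis using r(1) by (simp add: power_divide pos_divide_le_eq flip: r(2))
  qed
  define e where "e = min (1/4) (\<eta>/5)"
  have e: "0 < e" "e \<le> 1/4" "5 * e \<le> \<eta>" using \<eta> by (auto simp: e_def)
  have "inscribed \<phi> ((1 - e) *\<^sub>R p0) ((1 + 2*e) *\<^sub>R q0)"
    unfolding inscribed_def
  proof (intro allI)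
    fix c s :: real
    define c' where "c' = c * (1 - e)"
    define s' where "s' = s * (1 + 2*e)"
    have c': "c'\<^sup>2 \<le> c\<^sup>2"
      using e mult_left_mono[of "(1-e)\<^sup>2" 1 "c\<^sup>2"]
      by (simp add: c'_def power_mult_distrib power_le_one)
    have s': "s\<^sup>2 \<le> s'\<^sup>2"
      using e mult_left_mono[of 1 "(1+2*e)\<^sup>2" "s\<^sup>2"]
      by (simp add: s'_def power_mult_distrib one_le_power)
    have "(norm (\<phi> (c' *\<^sub>R p0 + s' *\<^sub>R q0)))\<^sup>2 \<le> c\<^sup>2 + s\<^sup>2"
    proof (cases "5 * s'\<^sup>2 \<ge> c'\<^sup>2 + s'\<^sup>2")
      case True
      have ee: "(1 + 2*e)\<^sup>2 \<le> 1 + 5 * e"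
        using e mult_right_mono[of "4*e" 1 e] by (simp add: power2_eq_square algebra_simps)
      have "s'\<^sup>2 = (1+2*e)\<^sup>2 * s\<^sup>2" by (simp add: s'_def power_mult_distrib)
      also have "\<dots> \<le> (1 + 5*e) * s\<^sup>2" using ee by (intro mult_right_mono) auto
      also have "\<dots> \<le> (1 + \<eta>) * s\<^sup>2" using e by (intro mult_right_mono) auto
      finally have 1: "s'\<^sup>2 \<le> (1 + \<eta>) * s\<^sup>2" .
      have "c'\<^sup>2 \<le> (1 + \<eta>) * c\<^sup>2" using c' \<eta> by (simp add: algebra_simps add_increasing2)
      with 1 have 2: "c'\<^sup>2 + s'\<^sup>2 \<le> (1 + \<eta>) * (c\<^sup>2 + s\<^sup>2)" by (simp add: algebra_simps)
      have \<eta>1: "\<eta> \<le> 1" by (simp add: \<eta>_def)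
      have "(norm (\<phi> (c' *\<^sub>R p0 + s' *\<^sub>R q0)))\<^sup>2 \<le> (1 - \<eta>) * (c'\<^sup>2 + s'\<^sup>2)" by (rule far[OF True])
      also have "\<dots> \<le> (1 - \<eta>) * ((1 + \<eta>) * (c\<^sup>2 + s\<^sup>2))" using 2 \<eta>1 by (intro mult_left_mono) auto
      also have "\<dots> = (1 - \<eta>\<^sup>2) * (c\<^sup>2 + s\<^sup>2)" by algebra
      also have "\<dots> \<le> 1 * (c\<^sup>2 + s\<^sup>2)" by (intro mult_right_mono) auto
      finally show ?thesis by simp
    next
      case False
      with c' s' have sc: "4 * s\<^sup>2 \<le> c\<^sup>2" by simp
      have "c'\<^sup>2 + s'\<^sup>2 = c\<^sup>2 + s\<^sup>2 + e * ((4 + 4*e) * s\<^sup>2 - (2 - e) * c\<^sup>2)"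
        unfolding c'_def s'_def by algebra
      moreover have "(1 + e) * (4 * s\<^sup>2) \<le> (2 - e) * c\<^sup>2"
        using e sc by (intro mult_mono) auto
      then have "e * ((4 + 4*e) * s\<^sup>2 - (2 - e) * c\<^sup>2) \<le> 0"
        using e(1) by (intro mult_nonneg_nonpos) (auto simp: algebra_simps)
      ultimately show ?thesis using ins0[of c' s'] by simp
    qed
    then show "(norm (\<phi> (c *\<^sub>R (1 - e) *\<^sub>R p0 + s *\<^sub>R (1 + 2*e) *\<^sub>R q0)))\<^sup>2 \<le> c\<^sup>2 + s\<^sup>2"
      by (simp add: c'_def s'_def)
  qed
  from max[OF this] have "area ((1 - e) *\<^sub>R p0) ((1 + 2*e) *\<^sub>R q0) \<le> area p q" .
  moreover have "area ((1 - e) *\<^sub>R p0) ((1 + 2*e) *\<^sub>R q0) = ((1 - e) * (1 + 2*e)) * ((a\<^sup>2 + b\<^sup>2) * area p q)"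
    by (simp add: area_def p0_def q0_def) algebra
  ultimately have "(1 - e) * (1 + 2*e) * area p q \<le> 1 * area p q" using unit by simp
  then have "(1 - e) * (1 + 2*e) \<le> 1" using pos mult_le_cancel_right_pos by blast
  moreover have "(1 - e) * (1 + 2*e) = 1 + e * (1 - 2*e)" by algebra
  moreover have "e * (1 - 2*e) > 0" using e by simp
  ultimately show False by simp
qed

text \<open>
  The parallelogram law for unit vectors, that is, for parallelograms with equal sides.
\<close>

definition rhombus_law :: "'a::real_normed_vector itself \<Rightarrow> bool" where
  "rhombus_law A \<longleftrightarrow>
    (\<forall>u v :: 'a. norm u = 1 \<and> norm v = 1 \<longrightarrow> (norm (u + v))\<^sup>2 + (norm (u - v))\<^sup>2 = 4)"

lemma closed_midpoint_imp_interval: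
  fixes Z :: "real set"
  assumes "closed Z" and ends: "a \<in> Z" "b \<in> Z"
    and mid: "\<And>x y. x \<in> Z \<Longrightarrow> y \<in> Z \<Longrightarrow> a \<le> x \<Longrightarrow> x < y \<Longrightarrow> y \<le> b \<Longrightarrow> (x + y) / 2 \<in> Z"
  shows "{a..b} \<subseteq> Z"
proof (rule ccontr)
  assume "\<not> {a..b} \<subseteq> Z"
  then obtain c where c: "a \<le> c" "c \<le> b" "c \<notin> Z" by (meson atLeastAtMost_iff subsetI)
  have "compact (Z \<inter> {a..c})" "compact (Z \<inter> {c..b})"
    using \<open>closed Z\<close> by (auto intro: closed_Int_compact)
  moreover have "Z \<inter> {a..c} \<noteq> {}" "Z \<inter> {c..b} \<noteq> {}" using ends c by auto
  ultimately obtain x y where x: "x \<in> Z \<inter> {a..c}" "\<And>t. t \<in> Z \<inter> {a..c} \<Longrightarrow> t \<le> x"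
    and y: "y \<in> Z \<inter> {c..b}" "\<And>t. t \<in> Z \<inter> {c..b} \<Longrightarrow> y \<le> t"
    using compact_attains_sup[of "Z \<inter> {a..c}"] compact_attains_inf[of "Z \<inter> {c..b}"] by metis
  have xy: "x < c" "c < y" using x y c by (auto simp: less_le)
  then have "(x + y) / 2 \<in> Z" using x y by (intro mid) auto
  moreover have "x < (x + y) / 2" "(x + y) / 2 < y" using xy by auto
  ultimately show False
    using x(1) y(1) x(2)[of "(x + y) / 2"] y(2)[of "(x + y) / 2"] by (cases "(x + y) / 2 \<le> c") auto
qed

text \<open>
  A unit vector is reached from the unit vector \<open>w\<close> by adding the oriented angle between them.
\<close>

lemma cis_eq_Arg_shift:
  assumes "norm w = 1" "norm z = 1" "w = cis \<alpha>"
  shows "cis (\<alpha> + Arg (cnj w * z)) = z"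
proof -
  have "norm (cnj w * z) = 1" using assms by (simp add: norm_mult)
  then have "cis (Arg (cnj w * z)) = cnj w * z"
    by (metis cis_Arg sgn_div_norm inverse_1 scaleR_one norm_zero zero_neq_one)
  then have "cis (\<alpha> + Arg (cnj w * z)) = (w * cnj w) * z"
    by (simp add: cis_mult[symmetric] assms(3) mult.assoc)
  also have "w * cnj w = 1" using assms(1) by (metis complex_norm_square of_real_1 one_power2)
  finally show ?thesis by simp
qed

text \<open>
  A linear map from the Euclidean plane that is norm-decreasing, and norm-preserving on two
  different lines, is isometric: by the rhombus law, norm preservation in two directions passes
  to their bisectors.
\<close>

lemma contraction_touching_isometric:
  fixes \<psi> :: "complex \<Rightarrow> 'a::real_normed_vector"
  assumes rhombus: "rhombus_law TYPE('a)" and lin: "bounded_linear \<psi>"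
    and le: "\<And>z. norm (\<psi> z) \<le> norm z"
    and w1: "norm w1 = 1" "norm (\<psi> w1) = 1" and w2: "norm w2 = 1" "norm (\<psi> w2) = 1"
    and indep: "Im (cnj w1 * w2) \<noteq> 0"
  shows "norm (\<psi> z) = norm z"
proof -
  interpret \<psi>: bounded_linear \<psi> by fact
  define Z where "Z = {\<theta>. norm (\<psi> (cis \<theta>)) = 1}"
  have "closed Z" unfolding Z_def
    by (intro closed_Collect_eq continuous_intros \<psi>.continuous_on)
  \<comment> \<open>For two angles in \<open>Z\<close> the sum and the difference of the unit vectors point along
      the two bisectors; neither can lose norm, since their squares add up to 4.\<close>
  have mid: "(x + y) / 2 \<in> Z" if "x \<in> Z" "y \<in> Z" "x < y" "y < x + pi" for x y
  proof -
    define C where "C = cos ((x - y) / 2)"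
    define S where "S = sin ((x - y) / 2)"
    have CS: "C\<^sup>2 + S\<^sup>2 = 1" by (simp add: C_def S_def)
    have "cos ((y - x) / 2) > 0" using that by (intro cos_gt_zero_pi) auto
    then have C: "C > 0" by (metis C_def cos_minus minus_diff_eq minus_divide_left)
    have sum: "cis x + cis y = (2 * C) *\<^sub>R cis ((x + y) / 2)"
      by (simp add: complex_eq_iff cos_plus_cos sin_plus_sin C_def)
    have "sin ((y - x) / 2) = - S"
      unfolding S_def by (metis minus_diff_eq minus_divide_left sin_minus)
    then have diff: "cis x - cis y = (2 * S) *\<^sub>R (\<i> * cis ((x + y) / 2))"
      by (simp add: complex_eq_iff cos_diff_cos sin_diff_sin flip: S_def)
    have "(norm (\<psi> (cis x) + \<psi> (cis y)))\<^sup>2 + (norm (\<psi> (cis x) - \<psi> (cis y)))\<^sup>2 = 4"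
      using rhombus that(1,2) by (simp add: rhombus_law_def Z_def)
    then have "(norm (\<psi> (cis x + cis y)))\<^sup>2 + (norm (\<psi> (cis x - cis y)))\<^sup>2 = 4"
      by (simp add: \<psi>.add \<psi>.diff)
    moreover have "(norm (\<psi> (cis x - cis y)))\<^sup>2 \<le> (2 * S)\<^sup>2"
      using power_mono[OF le[of "cis x - cis y"], of 2] unfolding diff
        by (simp add: norm_mult power_mult_distrib)
    moreover have "(norm (\<psi> (cis x + cis y)))\<^sup>2 = (2 * C)\<^sup>2 * (norm (\<psi> (cis ((x + y) / 2))))\<^sup>2"
      unfolding sum by (simp add: \<psi>.scaleR power_mult_distrib)
    ultimately have "4 * C\<^sup>2 * 1 \<le> 4 * C\<^sup>2 * (norm (\<psi> (cis ((x + y) / 2))))\<^sup>2"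
      using CS by (simp add: power_mult_distrib)
    then have "1 \<le> (norm (\<psi> (cis ((x + y) / 2))))\<^sup>2" using C by simp
    then have "1 \<le> norm (\<psi> (cis ((x + y) / 2)))"
      by (simp add: power2_nonneg_ge_1_iff)
    then show ?thesis using le[of "cis ((x + y) / 2)"] by (simp add: Z_def)
  qed
  define \<alpha> where "\<alpha> = Arg w1"
  have w1\<alpha>: "w1 = cis \<alpha>"
    using w1 by (metis \<alpha>_def cis_Arg sgn_div_norm inverse_1 scaleR_one norm_zero zero_neq_one)
  \<comment> \<open>After a change of sign the second direction lies less than half a turn ahead of
      the first, so two arcs of length less than \<open>\<pi>\<close> cover a half circle.\<close>
  define w where "w = (if Im (cnj w1 * w2) > 0 then w2 else - w2)"
  have w: "norm w = 1" "norm (\<psi> w) = 1" "Im (cnj w1 * w) > 0"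
    using w2 indep by (auto simp: w_def \<psi>.neg)
  define \<beta> where "\<beta> = \<alpha> + Arg (cnj w1 * w)"
  have "0 < Arg (cnj w1 * w)" "Arg (cnj w1 * w) < pi"
    using w(3) Arg_lt_pi[of "cnj w1 * w"] by auto
  then have \<beta>: "\<alpha> < \<beta>" "\<beta> < \<alpha> + pi" by (auto simp: \<beta>_def)
  have "cis \<beta> = w" unfolding \<beta>_def by (rule cis_eq_Arg_shift) (use w1 w w1\<alpha> in auto)
  then have Z: "\<alpha> \<in> Z" "\<beta> \<in> Z" "\<alpha> + pi \<in> Z"
    using w w1 w1\<alpha> by (auto simp: Z_def cis_mult[symmetric] \<psi>.neg)
  have "{\<alpha>..\<beta>} \<subseteq> Z" by (rule closed_midpoint_imp_interval) (use \<open>closed Z\<close> Z \<beta> mid in auto)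
  moreover have "{\<beta>..\<alpha> + pi} \<subseteq> Z"
    by (rule closed_midpoint_imp_interval) (use \<open>closed Z\<close> Z \<beta> mid in auto)
  ultimately have arc: "{\<alpha>..\<alpha> + pi} \<subseteq> Z" by (metis Un_least ivl_disj_un_two_touch(4) \<beta> less_imp_le)
  have unit: "norm (\<psi> z) = 1" if z: "norm z = 1" "Im (cnj w1 * z) \<ge> 0" for z
  proof -
    have *: "cis (\<alpha> + Arg (cnj w1 * z)) = z" by (rule cis_eq_Arg_shift) (use w1 z w1\<alpha> in auto)
    have "0 \<le> Arg (cnj w1 * z)" using z(2) Arg_less_0[of "cnj w1 * z"] by (simp only: not_less)
    moreover have "Arg (cnj w1 * z) \<le> pi" using Arg_bounded by blast
    ultimately have "\<alpha> + Arg (cnj w1 * z) \<in> {\<alpha>..\<alpha> + pi}" by auto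
    with arc have "\<alpha> + Arg (cnj w1 * z) \<in> Z" by blast
    with * show ?thesis by (simp add: Z_def)
  qed
  have unit': "norm (\<psi> z) = 1" if z: "norm z = 1" for z
    using unit[of z] unit[of "-z"] z by (cases "Im (cnj w1 * z) \<ge> 0") (auto simp: \<psi>.neg)
  show ?thesis
  proof (cases "z = 0")
    case False
    then have "norm (\<psi> (z /\<^sub>R norm z)) = 1" by (intro unit') auto
    then show ?thesis using False by (simp add: \<psi>.scaleR field_simps)
  qed (simp add: \<psi>.zero)
qed

lemma rhombus_law_plane:
  fixes \<phi> :: "complex \<Rightarrow> 'a::real_normed_vector"
  assumes rhombus: "rhombus_law TYPE('a)"
    and lin: "bounded_linear \<phi>" and inj: "\<And>z. \<phi> z = 0 \<Longrightarrow> z = 0"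
  obtains p q where "area p q \<noteq> 0" "\<And>c s. (norm (\<phi> (c *\<^sub>R p + s *\<^sub>R q)))\<^sup>2 = c\<^sup>2 + s\<^sup>2"
proof -
  interpret \<phi>: bounded_linear \<phi> by fact
  obtain p q where pq: "inscribed \<phi> p q" "area p q > 0"
    and max: "\<And>p' q'. inscribed \<phi> p' q' \<Longrightarrow> area p' q' \<le> area p q"
    using ex_maximal_inscribed[OF lin inj] by blast
  obtain a b :: real where ab: "a\<^sup>2 + b\<^sup>2 = 1" "norm (\<phi> (a *\<^sub>R p + b *\<^sub>R q)) = 1"
    by (rule maximal_inscribed_touches[OF lin pq max, of 1 0]) simp_all
  obtain c s :: real where cs: "c\<^sup>2 + s\<^sup>2 = 1" "norm (\<phi> (c *\<^sub>R p + s *\<^sub>R q)) = 1" "a * s - b * c \<noteq> 0"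
    using maximal_inscribed_touches[OF lin pq max ab(1)] by blast
  define \<psi> where "\<psi> z = \<phi> (Re z *\<^sub>R p + Im z *\<^sub>R q)" for z
  have "bounded_linear \<psi>" unfolding \<psi>_def
    by (intro bounded_linear_compose[OF lin] bounded_linear_add
        bounded_linear_compose[OF bounded_linear_scaleR_left] bounded_linear_Re bounded_linear_Im)
  moreover have "norm (\<psi> z) \<le> norm z" for z
    unfolding \<psi>_def cmod_def using inscribedD[OF pq(1)] by (intro real_le_rsqrt)
  ultimately have iso: "norm (\<psi> z) = norm z" for z
    by (rule contraction_touching_isometric[OF rhombus, where ?w1.0 = "Complex a b" and ?w2.0 = "Complex c s"])
       (use ab cs in \<open>auto simp: \<psi>_def cmod_def\<close>)
  have "(norm (\<phi> (c *\<^sub>R p + s *\<^sub>R q)))\<^sup>2 = c\<^sup>2 + s\<^sup>2" for c s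
    using iso[of "Complex c s"] by (simp add: \<psi>_def cmod_def)
  with pq(2) that[of p q] show ?thesis by simp
qed

text \<open>
  Day's theorem, in the form of an explicit formula for the norm of a linear combination.
\<close>

theorem rhombus_law_norm_combination:
  fixes u v :: "'a::real_normed_vector"
  assumes rhombus: "rhombus_law TYPE('a)" and u: "norm u = 1" and v: "norm v = 1"
  shows "(norm (a *\<^sub>R u + b *\<^sub>R v))\<^sup>2 = a\<^sup>2 + b\<^sup>2 + a * b * (2 - (norm (u - v))\<^sup>2)"
proof (cases "\<exists>z::complex. z \<noteq> 0 \<and> Re z *\<^sub>R u + Im z *\<^sub>R v = 0")
  case True
  then obtain z :: complex where z: "z \<noteq> 0" "Re z *\<^sub>R u = - (Im z *\<^sub>R v)"
    by (auto simp: eq_neg_iff_add_eq_0)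
  then have "\<bar>Re z\<bar> = \<bar>Im z\<bar>" using u v by (metis norm_minus_cancel norm_scaleR mult.right_neutral)
  then have "Re z = Im z \<or> Re z = - Im z" "Im z \<noteq> 0" using z(1) by (auto simp: complex_eq_iff)
  then have "u = v \<or> u = - v" using z(2)
    by (metis scaleR_minus_left scaleR_minus_right neg_equal_iff_equal real_vector.scale_left_imp_eq)
  then show ?thesis
  proof
    assume "u = v"
    then have "a *\<^sub>R u + b *\<^sub>R v = (a + b) *\<^sub>R u" by (simp add: scaleR_left_distrib)
    then have "(norm (a *\<^sub>R u + b *\<^sub>R v))\<^sup>2 = (a + b)\<^sup>2" using u by simp
    then show ?thesis using \<open>u = v\<close> by (simp add: power2_sum)
  next
    assume "u = - v"
    then have "a *\<^sub>R u + b *\<^sub>R v = (a - b) *\<^sub>R u" "u - v = 2 *\<^sub>R u"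
      by (simp_all add: scaleR_left_diff_distrib scaleR_2)
    then have "(norm (a *\<^sub>R u + b *\<^sub>R v))\<^sup>2 = (a - b)\<^sup>2" "(norm (u - v))\<^sup>2 = 4" using u by simp_all
    then show ?thesis by (simp add: power2_diff)
  qed
next
  case False
  define \<phi> where "\<phi> z = Re z *\<^sub>R u + Im z *\<^sub>R v" for z
  have lin: "bounded_linear \<phi>" unfolding \<phi>_def
    by (intro bounded_linear_add
        bounded_linear_compose[OF bounded_linear_scaleR_left] bounded_linear_Re bounded_linear_Im)
  then interpret \<phi>: bounded_linear \<phi> .
  obtain p q where pq: "area p q \<noteq> 0" "\<And>c s. (norm (\<phi> (c *\<^sub>R p + s *\<^sub>R q)))\<^sup>2 = c\<^sup>2 + s\<^sup>2"
    using rhombus_law_plane[OF rhombus lin] False by (metis \<phi>_def)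
  \<comment> \<open>Cramer coefficients of the standard basis with respect to \<open>p\<close> and \<open>q\<close>.\<close>
  define A where "A = area p q"
  define c1 s1 c2 s2 where "c1 = Im q / A" and "s1 = - Im p / A" and "c2 = - Re q / A" and "s2 = Re p / A"
  have "c1 * Re p + s1 * Re q = 1" "c1 * Im p + s1 * Im q = 0"
    "c2 * Re p + s2 * Re q = 0" "c2 * Im p + s2 * Im q = 1"
    using pq(1)
      by (simp_all add: c1_def s1_def c2_def s2_def A_def diff_divide_distrib[symmetric] add_divide_distrib[symmetric])
      (simp_all add: area_def field_simps)
  then have "x = (x * c1 + y * c2) * Re p + (x * s1 + y * s2) * Re q"
    "y = (x * c1 + y * c2) * Im p + (x * s1 + y * s2) * Im q" for x y
    by algebra+
  then have comb: "Complex x y = (x * c1 + y * c2) *\<^sub>R p + (x * s1 + y * s2) *\<^sub>R q" for x y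
    unfolding complex_eq_iff by simp
  have Q: "(norm (x *\<^sub>R u + y *\<^sub>R v))\<^sup>2 = (x * c1 + y * c2)\<^sup>2 + (x * s1 + y * s2)\<^sup>2" for x y
    using pq(2)[of "x * c1 + y * c2" "x * s1 + y * s2"] unfolding comb[symmetric]
      by (simp add: \<phi>_def)
  have "c1\<^sup>2 + s1\<^sup>2 = 1" "c2\<^sup>2 + s2\<^sup>2 = 1" using Q[of 1 0] Q[of 0 1] u v by auto
  moreover have "(norm (u - v))\<^sup>2 = (c1 - c2)\<^sup>2 + (s1 - s2)\<^sup>2" using Q[of 1 "-1"] by simp
  ultimately show ?thesis unfolding Q by algebra
qed

section \<open>The Mazur--Ulam property from the parallelogram law\<close>

lemma parallelogram_imp_rhombus_law:
  assumes "\<And>x y :: 'a::real_normed_vector. (norm (x + y))\<^sup>2 + (norm (x - y))\<^sup>2 = 2 * (norm x)\<^sup>2 + 2 * (norm y)\<^sup>2"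
  shows "rhombus_law TYPE('a)"
  using assms by (simp add: rhombus_law_def)

lemma parallelogram_unique_midpoint:
  fixes x y z :: "'a::real_normed_vector"
  assumes par: "\<And>x y :: 'a. (norm (x + y))\<^sup>2 + (norm (x - y))\<^sup>2 = 2 * (norm x)\<^sup>2 + 2 * (norm y)\<^sup>2"
    and "norm (z - x) = norm (x - y) / 2" "norm (z - y) = norm (x - y) / 2"
  shows "z = (1/2) *\<^sub>R (x + y)"
proof -
  have "(norm ((z - x) + (z - y)))\<^sup>2 + (norm ((z - x) - (z - y)))\<^sup>2 = (norm (x - y))\<^sup>2"
    unfolding par assms(2,3) by (simp add: power_divide)
  moreover have "(z - x) - (z - y) = - (x - y)" by simp
  ultimately have "(z - x) + (z - y) = 0"
    by (metis add_cancel_left_left norm_minus_cancel norm_eq_zero power2_eq_iff_nonneg power_eq_0_iff)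
  then have "2 *\<^sub>R z = x + y" by (simp add: scaleR_2 algebra_simps)
  then show ?thesis
    by (metis divide_self_if scaleR_scaleR scaleR_one times_divide_eq_left mult_1 zero_neq_numeral)
qed

theorem parallelogram_imp_mazur_ulam:
  assumes par: "\<And>x y :: 'x::banach. (norm (x + y))\<^sup>2 + (norm (x - y))\<^sup>2 = 2 * (norm x)\<^sup>2 + 2 * (norm y)\<^sup>2"
  shows "mazur_ulam_property TYPE('x) TYPE('y::banach)"
  unfolding mazur_ulam_property_def
proof (intro allI impI, elim conjE)
  fix \<Delta> :: "'x \<Rightarrow> 'y"
  assume surj: "\<Delta> ` sphere 0 1 = sphere 0 1"
    and "\<forall>x\<in>sphere 0 1. \<forall>y\<in>sphere 0 1. dist (\<Delta> x) (\<Delta> y) = dist x y"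
  then have iso: "norm (\<Delta> x - \<Delta> y) = norm (x - y)" if "norm x = 1" "norm y = 1" for x y
    using that by (simp add: dist_norm)
  have unit: "norm (\<Delta> x) = 1" if "norm x = 1" for x
    using surj that by (metis image_eqI mem_sphere_0)
  have preimage: "\<exists>x. norm x = 1 \<and> \<Delta> x = u" if "norm u = 1" for u
    using surj that by (metis imageE mem_sphere_0)
  \<comment> \<open>The preimage of \<open>- \<Delta> x\<close> is a unit vector at distance 2 from \<open>x\<close>, hence \<open>- x\<close>.\<close>
  have odd: "\<Delta> (- x) = - \<Delta> x" if x: "norm x = 1" for x
  proof -
    obtain z where z: "norm z = 1" "\<Delta> z = - \<Delta> x" using preimage[of "- \<Delta> x"] unit[OF x] by auto
    have "norm (\<Delta> z - \<Delta> x) = norm (2 *\<^sub>R \<Delta> x)" by (simp add: z(2) scaleR_2 norm_minus_commute)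
    then have "norm (z - x) = 2" using iso[OF z(1) x] unit[OF x] by simp
    then have "z + x = 0" using par[of z x] z(1) x by simp
    then show ?thesis using z(2) by (metis eq_neg_iff_add_eq_0)
  qed
  have rhombus: "rhombus_law TYPE('y)"
    unfolding rhombus_law_def
  proof (intro allI impI, elim conjE)
    fix u v :: 'y
    assume "norm u = 1" "norm v = 1"
    then obtain x y where xy: "norm x = 1" "u = \<Delta> x" "norm y = 1" "v = \<Delta> y" using preimage by metis
    then have "norm (u + v) = norm (x + y)" using iso[of x "- y"] odd by simp
    then show "(norm (u + v))\<^sup>2 + (norm (u - v))\<^sup>2 = 4" using par[of x y] xy iso by simp
  qed
  define T where "T x = norm x *\<^sub>R \<Delta> (x /\<^sub>R norm x)" for x
  have T_scale: "T (r *\<^sub>R x) = r *\<^sub>R \<Delta> x" if "norm x = 1" for r x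
  proof -
    consider "r > 0" | "r = 0" | "r < 0" by linarith
    then show ?thesis
    proof cases
      case 3
      then have "(r *\<^sub>R x) /\<^sub>R norm (r *\<^sub>R x) = - x" using that by (simp add: inverse_eq_divide)
      then show ?thesis using 3 that odd by (simp add: T_def)
    qed (use that in \<open>simp_all add: T_def\<close>)
  qed
  show "\<exists>T. linear T \<and> surj T \<and> (\<forall>x y. dist (T x) (T y) = dist x y) \<and> (\<forall>x\<in>sphere 0 1. T x = \<Delta> x)"
  proof (cases "\<exists>w :: 'x. norm w = 1")
    case False
    then have no_y: "norm u \<noteq> 1" for u :: 'y using preimage by blast
    \<comment> \<open>Without unit vectors both spaces are trivial.\<close>
    have x0: "x = 0" for x :: 'x using False by (metis norm_eq_zero norm_sgn)
    have y0: "y = 0" for y :: 'y using no_y by (metis norm_eq_zero norm_sgn)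
    have "linear (\<lambda>x::'x. 0::'y)" by (rule linear_zero)
    moreover have "surj (\<lambda>x::'x. 0::'y)" unfolding surj_def using y0 by metis
    moreover have "dist (0::'y) 0 = dist x y" for x y :: 'x using x0[of x] x0[of y] by simp
    moreover have "0 = \<Delta> x" for x using y0 by metis
    ultimately show ?thesis by blast
  next
    case True
    then obtain w0 :: 'x where w0: "norm w0 = 1" by blast
    have polar_x: "\<exists>r w. norm w = 1 \<and> x = r *\<^sub>R w" for x :: 'x
    proof (cases "x = 0")
      case False
      then have "norm (sgn x) = 1" "x = norm x *\<^sub>R sgn x" by (simp_all add: norm_sgn sgn_div_norm)
      then show ?thesis by blast
    qed (use w0 in \<open>auto intro: exI[of _ 0]\<close>)
    have polar_y: "\<exists>r u. norm u = 1 \<and> y = r *\<^sub>R u" for y :: 'y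
    proof (cases "y = 0")
      case False
      then have "norm (sgn y) = 1" "y = norm y *\<^sub>R sgn y" by (simp_all add: norm_sgn sgn_div_norm)
      then show ?thesis by blast
    qed (use unit[OF w0] in \<open>auto intro: exI[of _ 0]\<close>)
    have T_dist: "norm (T x - T y) = norm (x - y)" for x y
    proof -
      obtain a w where x: "norm w = 1" "x = a *\<^sub>R w" using polar_x by blast
      obtain b z where y: "norm z = 1" "y = b *\<^sub>R z" using polar_x by blast
      have "(norm (T x - T y))\<^sup>2 = a\<^sup>2 + (- b)\<^sup>2 + a * (- b) * (2 - (norm (\<Delta> w - \<Delta> z))\<^sup>2)"
        using rhombus_law_norm_combination[OF rhombus unit[OF x(1)] unit[OF y(1)], of a "- b"]
        by (simp add: x y T_scale)
      moreover have "(norm (x - y))\<^sup>2 = a\<^sup>2 + (- b)\<^sup>2 + a * (- b) * (2 - (norm (w - z))\<^sup>2)"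
        using rhombus_law_norm_combination[OF parallelogram_imp_rhombus_law[OF par] x(1) y(1), of a "- b"]
        by (simp add: x y)
      ultimately have "(norm (T x - T y))\<^sup>2 = (norm (x - y))\<^sup>2" using iso x(1) y(1) by simp
      then show ?thesis by simp
    qed
    have T_surj: "\<exists>x. T x = y" for y
    proof -
      obtain r u where "norm u = 1" "y = r *\<^sub>R u" using polar_y by blast
      then show ?thesis using preimage T_scale by metis
    qed
    have T_scaleR: "T (r *\<^sub>R x) = r *\<^sub>R T x" for r x
    proof -
      obtain a w where "norm w = 1" "x = a *\<^sub>R w" using polar_x by blast
      then show ?thesis using T_scale[of w "r * a"] T_scale[of w a] by simp
    qed
    have T_add: "T (x + y) = T x + T y" for x y
    proof -
      obtain z where z: "T z = (1/2) *\<^sub>R (T x + T y)" using T_surj by metis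
      have "T z - T x = (1/2) *\<^sub>R (T y - T x)" "T z - T y = (1/2) *\<^sub>R (T x - T y)"
        by (simp_all add: z algebra_simps flip: scaleR_add_left)
      then have "norm (T z - T x) = norm (T x - T y) / 2" "norm (T z - T y) = norm (T x - T y) / 2"
        by (simp_all add: norm_minus_commute)
      then have "z = (1/2) *\<^sub>R (x + y)"
        unfolding T_dist by (rule parallelogram_unique_midpoint[OF par])
      then have "(1/2) *\<^sub>R T (x + y) = (1/2) *\<^sub>R (T x + T y)" using z T_scaleR by simp
      then show ?thesis by simp
    qed
    have "linear T" using T_add T_scaleR by (intro linearI)
    moreover have "surj T" using T_surj by (metis surjI surj_def)
    moreover have "T x = \<Delta> x" if "norm x = 1" for x using T_scale[OF that, of 1] by simp
    ultimately show ?thesis using T_dist by (intro exI[of _ T]) (auto simp: dist_norm)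
  qed
qed

lemma real_inner_parallelogram:
  fixes x y :: "'a::real_inner"
  shows "(norm (x + y))\<^sup>2 + (norm (x - y))\<^sup>2 = 2 * (norm x)\<^sup>2 + 2 * (norm y)\<^sup>2"
  by (simp add: power2_norm_eq_inner algebra_simps)

lemma cinner_parallelogram:
  fixes x y :: "'a::complex_hilbert"
  shows "(norm (x + y))\<^sup>2 + (norm (x - y))\<^sup>2 = 2 * (norm x)\<^sup>2 + 2 * (norm y)\<^sup>2"
proof -
  have add_right: "cinner u (v + w) = cinner u v + cinner u w" for u v w :: 'a
    by (metis cinner_add_left cinner_commute complex_cnj_add)
  have diff_left: "cinner (u - v) w = cinner u w - cinner v w" for u v w :: 'a
    by (metis add_diff_cancel_right' cinner_add_left diff_add_cancel)
  have diff_right: "cinner u (v - w) = cinner u v - cinner u w" for u v w :: 'a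
    by (metis add_diff_cancel_right' add_right diff_add_cancel)
  have "cinner (x + y) (x + y) + cinner (x - y) (x - y) = 2 * cinner x x + 2 * cinner y y"
    by (simp add: cinner_add_left add_right diff_left diff_right)
  then have "complex_of_real ((norm (x + y))\<^sup>2 + (norm (x - y))\<^sup>2) = complex_of_real (2 * (norm x)\<^sup>2 + 2 * (norm y)\<^sup>2)"
    by (simp only: cinner_self of_real_add of_real_mult of_real_numeral)
  then show ?thesis by (simp only: of_real_eq_iff)
qed

section \<open>Triples in which every cube is a multiple of its root\<close>

interpretation cvs: vector_space "scaleC :: complex \<Rightarrow> 'a \<Rightarrow> 'a::complex_banach"
proof
  show "(a :: complex) *\<^sub>C (x + y) = a *\<^sub>C x + a *\<^sub>C y" for a and x y :: 'a
    by (rule scaleC_add_right)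
  show "(a + b) *\<^sub>C x = a *\<^sub>C x + b *\<^sub>C x" for a b and x :: 'a by (rule scaleC_add_left)
  show "a *\<^sub>C b *\<^sub>C x = (a * b) *\<^sub>C x" for a b and x :: 'a by (rule scaleC_scaleC)
  show "1 *\<^sub>C x = x" for x :: 'a using scaleR_scaleC[of 1 x] by simp
qed

lemma scaleC_of_real: "complex_of_real r *\<^sub>C x = r *\<^sub>R x"
  by (simp add: scaleR_scaleC)

lemma bounded_linear_scaleC: "bounded_linear (\<lambda>y :: 'a::complex_banach. c *\<^sub>C y)"
  by (rule bounded_linear_intro[of _ "cmod c"])
     (simp_all add: scaleC_add_right scaleR_scaleC mult.commute norm_scaleC)

text \<open>
  Comparison of coefficients for two vectors that are linearly independent over the complex
  numbers.
\<close>

lemma scaleC_independent_coeffs: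
  fixes e y :: "'a::complex_banach"
  assumes "\<nexists>c. y = c *\<^sub>C e" "e \<noteq> 0" "a *\<^sub>C e + b *\<^sub>C y = a' *\<^sub>C e + b' *\<^sub>C y"
  shows "a = a'" "b = b'"
proof -
  have 1: "(b - b') *\<^sub>C y = (a' - a) *\<^sub>C e"
    using assms(3) by (simp add: cvs.scale_left_diff_distrib algebra_simps)
  show "b = b'"
  proof (rule ccontr)
    assume "b \<noteq> b'"
    then have "y = (inverse (b - b') * (b - b')) *\<^sub>C y" by simp
    also have "\<dots> = inverse (b - b') *\<^sub>C (a' - a) *\<^sub>C e" using 1 by (metis cvs.scale_scale)
    finally show False using assms(1) by (metis cvs.scale_scale)
  qed
  with 1 assms(2) show "a = a'" by simp
qed

context jb_star_triple
begin

lemma tp_scaleR_left: "tp (r *\<^sub>R a) b c = r *\<^sub>R tp a b c"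
  and tp_scaleR_middle: "tp a (r *\<^sub>R b) c = r *\<^sub>R tp a b c"
  and tp_scaleR_right: "tp a b (r *\<^sub>R c) = r *\<^sub>R tp a b c"
  by (simp_all add: scaleR_scaleC tp_scaleC_left tp_scaleC_middle tp_scaleC_right)

lemma linear_tp_left: "linear (\<lambda>a. tp a b c)"
  and linear_tp_middle: "linear (\<lambda>b. tp a b c)"
  and linear_tp_right: "linear (\<lambda>c. tp a b c)"
  by (intro linearI; simp add: tp_add_left tp_scaleR_left tp_add_middle tp_scaleR_middle
      tp_add_right tp_scaleR_right)+

text \<open>
  For a tripotent \<open>e\<close>, the operator \<open>L = L(e,e)\<close> and the conjugate-linear operator
  \<open>Q z = {e,z,e}\<close> satisfy \<open>LQ = QL = Q\<close> and \<open>Q\<^sup>2 = 2L\<^sup>2 - L\<close>. In particular \<open>Q\<^sup>2\<close> is the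
  projection onto the Peirce space \<open>E\<^sub>2\<close>.
\<close>

lemma tp_tripotent_Peirce:
  assumes e: "tp e e e = e"
  shows "tp e e (tp e z e) = tp e z e" (is "?L (?Q z) = ?Q z")
    and "tp e (tp e e z) e = tp e z e"
    and "tp e (tp e z e) e = 2 *\<^sub>R tp e e (tp e e z) - tp e e z"
proof -
  have LQ: "?L (?Q z) = 2 *\<^sub>R ?Q z - ?Q (?L z)"
    using jordan_identity[of e e e z e] by (simp add: e scaleR_2)
  have Q: "?Q z = 2 *\<^sub>R ?L (?Q z) - ?Q (?L z)"
    using jordan_identity[of e z e e e]
    by (simp add: e scaleR_2 tp_commute[of "tp e z e"] tp_commute[of z])
  have "?Q (?L z) = 2 *\<^sub>R ?Q z - ?L (?Q z)" using LQ by simp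
  with Q have "?Q z + 2 *\<^sub>R ?Q z = ?L (?Q z) + 2 *\<^sub>R ?L (?Q z)" by (simp add: algebra_simps)
  then have "(1 + 2) *\<^sub>R ?Q z = (1 + 2) *\<^sub>R ?L (?Q z)"
    by (simp only: scaleR_left_distrib scaleR_one)
  then show 1: "?L (?Q z) = ?Q z" by simp
  with LQ show "?Q (?L z) = ?Q z" by (simp add: scaleR_2)
  show "?Q (?Q z) = 2 *\<^sub>R ?L (?L z) - ?L z"
    using jordan_identity[of z e e e e]
    by (simp add: e scaleR_2 tp_commute[of z e e] tp_commute[of "tp e e z" e e] algebra_simps)
qed

lemma cube_expand:
  "tp (e + t *\<^sub>R y) (e + t *\<^sub>R y) (e + t *\<^sub>R y) =
    tp e e e + t *\<^sub>R (2 *\<^sub>R tp e e y + tp e y e)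
    + t\<^sup>2 *\<^sub>R (2 *\<^sub>R tp y y e + tp y e y) + t^3 *\<^sub>R tp y y y"
proof -
  have "tp (e + t *\<^sub>R y) (e + t *\<^sub>R y) (e + t *\<^sub>R y) =
    tp e e e + t *\<^sub>R (tp e e y + tp y e e + tp e y e)
    + t\<^sup>2 *\<^sub>R (tp y y e + tp e y y + tp y e y) + t^3 *\<^sub>R tp y y y"
    by (simp add: tp_add_left tp_add_middle tp_add_right tp_scaleR_left tp_scaleR_middle
        tp_scaleR_right scaleR_add_right power2_eq_square power3_eq_cube algebra_simps)
  then show ?thesis by (simp add: tp_commute[of y e e] tp_commute[of e y y] scaleR_2)
qed

end

text \<open>
  Triples in which every unit vector is a tripotent.
\<close>

locale cubic_jb_star_triple = jb_star_triple tp
  for tp :: "'e::complex_banach \<Rightarrow> 'e \<Rightarrow> 'e \<Rightarrow> 'e" +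
  assumes cube: "tp x x x = (norm x)\<^sup>2 *\<^sub>R x"
begin

text \<open>
  A joint eigenvector \<open>y\<close> of \<open>L(e,e)\<close> and \<open>Q\<close>, independent of the unit vector \<open>e\<close>, must satisfy
  \<open>2\<alpha> + \<beta> = 1\<close>. This excludes \<open>(\<alpha>, \<beta>) = (1, 1)\<close> and \<open>(0, 0)\<close>, that is, further vectors in the
  Peirce spaces \<open>E\<^sub>2\<close> and \<open>E\<^sub>0\<close>; it leaves \<open>(1/2, 0)\<close>, that is, \<open>E\<^sub>1\<close>.
\<close>

lemma joint_eigenvector:
  assumes e: "norm e = 1" and indep: "\<nexists>c. y = c *\<^sub>C e"
    and L: "tp e e y = \<alpha> *\<^sub>R y" and Q: "tp e y e = \<beta> *\<^sub>R y"
  shows "2 * \<alpha> + \<beta> = 1" and "(norm (e + y))\<^sup>2 = 1 + (norm y)\<^sup>2"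
proof -
  define w where "w = 2 *\<^sub>R tp y y e + tp y e y"
  define N where "N t = (norm (e + t *\<^sub>R y))\<^sup>2" for t
  define \<kappa> where "\<kappa> = 2 * \<alpha> + \<beta>"
  define n where "n = (norm y)\<^sup>2"
  have e0: "e \<noteq> 0" using e by auto
  \<comment> \<open>The cube of \<open>e + t y\<close> is computed by expansion and by the cube law; \<open>t = 1\<close>
      expresses \<open>w\<close> by \<open>e\<close> and \<open>y\<close>, after which coefficients can be compared for
      \<open>t = -1\<close> and \<open>t = 2\<close>.\<close>
  have eq: "t\<^sup>2 *\<^sub>R w = (N t - 1) *\<^sub>R e + (N t * t - \<kappa> * t - n * t^3) *\<^sub>R y" for t
    using cube_expand[of e t y] e cube[of "e + t *\<^sub>R y"] cube[of e] cube[of y]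
    by (simp add: L Q w_def N_def \<kappa>_def n_def algebra_simps)
  have w: "w = (N 1 - 1) *\<^sub>R e + (N 1 - \<kappa> - n) *\<^sub>R y" using eq[of 1] by simp
  have coeffs: "t\<^sup>2 * (N 1 - 1) = N t - 1 \<and> t\<^sup>2 * (N 1 - \<kappa> - n) = N t * t - \<kappa> * t - n * t^3" for t
  proof -
    have "complex_of_real (t\<^sup>2 * (N 1 - 1)) *\<^sub>C e + complex_of_real (t\<^sup>2 * (N 1 - \<kappa> - n)) *\<^sub>C y =
      complex_of_real (N t - 1) *\<^sub>C e + complex_of_real (N t * t - \<kappa> * t - n * t^3) *\<^sub>C y"
      using eq[of t] unfolding w scaleC_of_real by (simp add: scaleR_add_right)
    from scaleC_independent_coeffs[OF indep e0 this] show ?thesis by (simp only: of_real_eq_iff)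
  qed
  have "N (-1) = N 1" using coeffs[of "-1"] by simp
  moreover have "N 1 - \<kappa> - n = - N (-1) + \<kappa> + n" using coeffs[of "-1"] by simp
  ultimately have 1: "N 1 = \<kappa> + n" by linarith
  have "2 * N 2 = 2 * \<kappa> + 8 * n" using coeffs[of 2] 1 by simp
  moreover have "N 2 = 1 + 4 * (N 1 - 1)" using coeffs[of 2] by simp
  ultimately have "\<kappa> = 1" using 1 by simp
  with 1 show "2 * \<alpha> + \<beta> = 1" "(norm (e + y))\<^sup>2 = 1 + (norm y)\<^sup>2"
    by (simp_all add: \<kappa>_def N_def n_def)
qed

text \<open>
  The range of \<open>Q\<^sup>2\<close> is spanned by \<open>e\<close>, since \<open>Q z + Q\<^sup>2 z\<close> and \<open>i (Q z - Q\<^sup>2 z)\<close> are fixed by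
  \<open>L\<close> and \<open>Q\<close>.
\<close>

lemma Peirce_2_trivial:
  assumes e: "norm e = 1"
  shows "\<exists>c. tp e (tp e z e) e = c *\<^sub>C e"
proof -
  have tri: "tp e e e = e" using cube[of e] e by simp
  note Peirce = tp_tripotent_Peirce[OF tri]
  define q where "q = tp e z e"
  define p where "p = tp e q e"
  have q: "tp e e q = q" using Peirce(1)[of z] by (simp add: q_def)
  have p: "tp e e p = p" using Peirce(1)[of q] by (simp add: p_def)
  have p': "tp e p e = q" using Peirce(3)[of q] q by (simp add: p_def scaleR_2)
  have fixed: "\<exists>c. u = c *\<^sub>C e" if "tp e e u = u" "tp e u e = u" for u
    using joint_eigenvector(1)[OF e, of u 1 1] that by auto
  obtain a where a: "q + p = a *\<^sub>C e"
    using fixed[of "q + p"] q p p'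
      by (auto simp: tp_add_right tp_add_middle p_def[symmetric] add.commute)
  have diff: "tp e e (q - p) = q - p" "tp e (q - p) e = - (q - p)"
    using q p p' linear_diff[OF linear_tp_right] linear_diff[OF linear_tp_middle]
      by (simp_all add: p_def[symmetric])
  obtain b where b: "\<i> *\<^sub>C (q - p) = b *\<^sub>C e"
    using fixed[of "\<i> *\<^sub>C (q - p)"]
    by (auto simp only: tp_scaleC_right tp_scaleC_middle diff complex_cnj_i cvs.scale_minus_left
        cvs.scale_minus_right minus_minus)
  have "q - p = (- \<i> * \<i>) *\<^sub>C (q - p)" by simp
  also have "\<dots> = (- \<i> * b) *\<^sub>C e" using b by (metis cvs.scale_scale)
  finally have "q + p - (q - p) = (a + \<i> * b) *\<^sub>C e" using a by (simp add: cvs.scale_left_distrib)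
  then have "2 *\<^sub>C p = (a + \<i> * b) *\<^sub>C e" using scaleC_of_real[of 2 p] by (simp add: scaleR_2)
  then have "p = (inverse 2 * (a + \<i> * b)) *\<^sub>C e"
    by (metis cvs.scale_one cvs.scale_scale left_inverse zero_neq_numeral)
  then show ?thesis unfolding p_def q_def by (rule exI)
qed

lemma Peirce_decomposition:
  assumes e: "norm e = 1"
  obtains c y where "z = c *\<^sub>C e + y" "tp e e y = (1/2) *\<^sub>R y" "tp e y e = 0"
proof -
  have tri: "tp e e e = e" using cube[of e] e by simp
  have e0: "e \<noteq> 0" using e by auto
  note Peirce = tp_tripotent_Peirce[OF tri]
  obtain c where c: "tp e (tp e z e) e = c *\<^sub>C e" using Peirce_2_trivial[OF e] by blast
  define y where "y = z - c *\<^sub>C e"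
  have "tp e (tp e y e) e = 0"
    by (simp add: y_def linear_diff[OF linear_tp_middle] tp_scaleC_middle tri c)
  then have LL: "2 *\<^sub>R tp e e (tp e e y) = tp e e y" and "tp e (tp e (tp e y e) e) e = 0"
    using Peirce(3)[of y] linear_0[OF linear_tp_middle] by simp_all
  then have Q: "tp e y e = 0"
    using Peirce(3)[of "tp e y e"] Peirce(1)[of y] by (simp add: scaleR_2)
  \<comment> \<open>The component of \<open>y\<close> in \<open>E\<^sub>0\<close>; it is a multiple of \<open>e\<close>, hence zero.\<close>
  define x where "x = y - 2 *\<^sub>R tp e e y"
  have "tp e e x = 0"
    using LL by (simp add: x_def linear_diff[OF linear_tp_right] tp_scaleR_right)
  moreover have "tp e x e = 0"
    using Q Peirce(2)[of y] by (simp add: x_def linear_diff[OF linear_tp_middle] tp_scaleR_middle)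
  ultimately obtain d where d: "x = d *\<^sub>C e"
    using joint_eigenvector(1)[OF e, of x 0 0] by auto
  then have "tp e e x = x" by (simp add: tp_scaleC_right tri)
  with \<open>tp e e x = 0\<close> have "y = 2 *\<^sub>R tp e e y" by (simp add: x_def)
  then have "(1/2) *\<^sub>R y = tp e e y"
    by (metis divide_self_if scaleR_scaleR scaleR_one times_divide_eq_left mult_1 zero_neq_numeral)
  with Q show ?thesis using that[of c y] by (simp add: y_def)
qed

lemma Peirce_1_pythagoras:
  assumes e: "norm e = 1" and L: "tp e e y = (1/2) *\<^sub>R y" and Q: "tp e y e = 0"
  shows "(norm (a *\<^sub>C e + y))\<^sup>2 = (cmod a)\<^sup>2 + (norm y)\<^sup>2"
proof (cases "a = 0 \<or> y = 0")
  case True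
  then show ?thesis using e by (auto simp: norm_scaleC)
next
  case False
  then have a: "a \<noteq> 0" and y: "y \<noteq> 0" by auto
  have tri: "tp e e e = e" using cube[of e] e by simp
  define y' where "y' = inverse a *\<^sub>C y"
  have "\<nexists>c. y' = c *\<^sub>C e"
  proof
    assume "\<exists>c. y' = c *\<^sub>C e"
    then obtain c where "y' = c *\<^sub>C e" by blast
    then have "tp e e y' = y'" by (simp add: tp_scaleC_right tri)
    moreover have "tp e e y' = (1/2) *\<^sub>R y'"
      by (simp add: y'_def tp_scaleC_right L scaleR_scaleC mult.commute)
    ultimately have "(1 - 1/2) *\<^sub>R y' = 0" by (simp only: scaleR_left_diff_distrib) simp
    then show False using a y by (simp add: y'_def)
  qed
  then have "(norm (e + y'))\<^sup>2 = 1 + (norm y')\<^sup>2"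
    using joint_eigenvector(2)[OF e, of y' "1/2" 0]
    by (simp add: y'_def tp_scaleC_right tp_scaleC_middle L Q scaleR_scaleC mult.commute)
  moreover have "a *\<^sub>C e + y = a *\<^sub>C (e + y')" "y = a *\<^sub>C y'"
    using a by (simp_all add: y'_def scaleC_add_right)
  ultimately show ?thesis
    by (simp add: norm_scaleC power_mult_distrib distrib_left)
qed

theorem parallelogram:
  fixes x z :: 'e
  shows "(norm (x + z))\<^sup>2 + (norm (x - z))\<^sup>2 = 2 * (norm x)\<^sup>2 + 2 * (norm z)\<^sup>2"
proof (cases "x = 0")
  case False
  define e where "e = sgn x"
  have e: "norm e = 1" and x: "x = complex_of_real (norm x) *\<^sub>C e"
    using False by (simp_all add: e_def norm_sgn scaleC_of_real sgn_div_norm)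
  obtain c y where z: "z = c *\<^sub>C e + y" and y: "tp e e y = (1/2) *\<^sub>R y" "tp e y e = 0"
    using Peirce_decomposition[OF e] by blast
  have y': "tp e e (- y) = (1/2) *\<^sub>R (- y)" "tp e (- y) e = 0"
    using y linear_neg[OF linear_tp_right] linear_neg[OF linear_tp_middle] by simp_all
  define r where "r = complex_of_real (norm x)"
  have sum: "x + z = (r + c) *\<^sub>C e + y" and diff: "x - z = (r - c) *\<^sub>C e + - y"
    by (subst x, simp add: r_def z algebra_simps cvs.scale_left_distrib cvs.scale_left_diff_distrib)+
  have "(cmod (r + c))\<^sup>2 + (cmod (r - c))\<^sup>2 = 2 * (norm x)\<^sup>2 + 2 * (cmod c)\<^sup>2"
    by (simp only: cmod_power2) (simp add: r_def power2_eq_square algebra_simps)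
  moreover have "(norm z)\<^sup>2 = (cmod c)\<^sup>2 + (norm y)\<^sup>2" using Peirce_1_pythagoras[OF e y] z by simp
  ultimately show ?thesis
    unfolding sum diff Peirce_1_pythagoras[OF e y] Peirce_1_pythagoras[OF e y'] by simp
qed simp

end

section \<open>Exponentials of bounded operators\<close>

lemma bounded_linear_funpow:
  fixes T :: "'a::real_normed_vector \<Rightarrow> 'a"
  assumes "bounded_linear T"
  shows "bounded_linear (T ^^ n)"
proof (induction n)
  case 0
  show ?case using bounded_linear_ident by (simp add: id_def)
next
  case (Suc n)
  then show ?case using bounded_linear_compose[OF assms Suc] by (simp add: o_def)
qed

lemma funpow_norm_bound:
  fixes T :: "'a::real_normed_vector \<Rightarrow> 'a"
  assumes "bounded_linear T"
  obtains K where "K \<ge> 0" "\<And>n x. norm ((T ^^ n) x) \<le> K ^ n * norm x"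
proof -
  obtain K where K: "K \<ge> 0" "\<And>x. norm (T x) \<le> norm x * K"
    using bounded_linear.nonneg_bounded[OF assms] by blast
  have "norm ((T ^^ n) x) \<le> K ^ n * norm x" for n x
  proof (induction n)
    case (Suc n)
    have "norm ((T ^^ Suc n) x) \<le> norm ((T ^^ n) x) * K" using K(2) by simp
    also have "\<dots> \<le> (K ^ n * norm x) * K" using Suc K(1) by (intro mult_right_mono)
    finally show ?case by (simp add: mult.commute mult.left_commute)
  qed simp
  with K(1) that show ?thesis by blast
qed

lemma summable_real_exp: "summable (\<lambda>n. K ^ n / fact n :: real)"
  using summable_exp_generic[of K] by (simp add: divide_inverse mult.commute)

lemma op_exp_summable_norm:
  fixes T :: "'a::banach \<Rightarrow> 'a"
  assumes "bounded_linear T"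
  shows "summable (\<lambda>n. norm ((T ^^ n) x /\<^sub>R fact n))"
proof -
  obtain K where K: "K \<ge> 0" "\<And>n x. norm ((T ^^ n) x) \<le> K ^ n * norm x"
    using funpow_norm_bound[OF assms] by blast
  have "norm (norm ((T ^^ n) x /\<^sub>R fact n)) \<le> (K ^ n / fact n) * norm x" for n
    using K(2)[of n x] by (simp add: field_simps)
  then show ?thesis
    by (intro summable_comparison_test'[OF summable_mult2[OF summable_real_exp]])
qed

lemma op_exp_sums:
  fixes T :: "'a::banach \<Rightarrow> 'a"
  assumes "bounded_linear T"
  shows "(\<lambda>n. (T ^^ n) x /\<^sub>R fact n) sums op_exp T x"
  unfolding op_exp_def
    by (rule summable_sums[OF summable_norm_cancel[OF op_exp_summable_norm[OF assms]]])

lemma linear_op_exp: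
  fixes T :: "'a::banach \<Rightarrow> 'a"
  assumes T: "bounded_linear T"
  shows "linear (op_exp T)"
proof (rule linearI)
  note [simp] = linear_add[OF bounded_linear.linear[OF bounded_linear_funpow[OF T]]]
    linear_scale[OF bounded_linear.linear[OF bounded_linear_funpow[OF T]]]
  show "op_exp T (x + y) = op_exp T x + op_exp T y" for x y
  proof (rule sums_unique2[OF op_exp_sums[OF T]])
    show "(\<lambda>n. (T ^^ n) (x + y) /\<^sub>R fact n) sums (op_exp T x + op_exp T y)"
      using sums_add[OF op_exp_sums[OF T, of x] op_exp_sums[OF T, of y]]
        by (simp add: scaleR_add_right)
  qed
  show "op_exp T (r *\<^sub>R x) = r *\<^sub>R op_exp T x" for r x
  proof (rule sums_unique2[OF op_exp_sums[OF T]])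
    show "(\<lambda>n. (T ^^ n) (r *\<^sub>R x) /\<^sub>R fact n) sums (r *\<^sub>R op_exp T x)"
      using sums_scaleR_right[OF op_exp_sums[OF T, of x], of r] by (simp add: mult.commute)
  qed
qed

text \<open>
  The Cauchy product of the two series, written as a double sum: summation by rows gives
  \<open>exp T (exp (-T) x)\<close>, summation along diagonals gives \<open>x\<close> by the binomial theorem.
\<close>

lemma op_exp_minus_inverse:
  fixes T :: "'a::banach \<Rightarrow> 'a"
  assumes T: "bounded_linear T"
  shows "op_exp T (op_exp (\<lambda>y. - T y) x) = x"
proof -
  obtain K where K: "K \<ge> 0" "\<And>n x. norm ((T ^^ n) x) \<le> K ^ n * norm x"
    using funpow_norm_bound[OF T] by blast
  have pow_minus: "((\<lambda>y. - T y) ^^ n) z = (-1) ^ n *\<^sub>R (T ^^ n) z" for n z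
    by (induction n) (simp_all add: linear_neg[OF bounded_linear.linear[OF T]] linear_scale[OF bounded_linear.linear[OF T]])
  have Tm: "bounded_linear (\<lambda>y. - T y)" using T by (rule bounded_linear_minus)
  define y where "y = op_exp (\<lambda>y. - T y) x"
  define a where "a = (\<lambda>(j, k). ((-1) ^ k / (fact j * fact k)) *\<^sub>R (T ^^ (j + k)) x)"
  have a_bound: "norm (a (j, k)) \<le> (K ^ j / fact j) * ((K ^ k / fact k) * norm x)" for j k
    using K(2)[of "j + k" x] by (simp add: a_def power_add abs_mult divide_simps mult_ac)
  have inner: "((\<lambda>k. (K ^ j / fact j) * ((K ^ k / fact k) * norm x)) has_sum
      (K ^ j / fact j) * ((\<Sum>k. K ^ k / fact k) * norm x)) UNIV" for j
    using K(1) by (intro has_sum_cmult_right has_sum_cmult_left sums_nonneg_imp_has_sum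
        summable_sums summable_real_exp) auto
  define M where "M = (\<Sum>k. K ^ k / fact k) * norm x"
  have "0 \<le> M" unfolding M_def
    using K(1) by (intro mult_nonneg_nonneg suminf_nonneg summable_real_exp) auto
  then have "(\<lambda>j. (K ^ j / fact j) * M) summable_on UNIV"
    using K(1) by (intro summable_nonneg_imp_summable_on summable_mult2 summable_real_exp) auto
  then have "(\<lambda>jk. (K ^ fst jk / fact (fst jk)) * ((K ^ snd jk / fact (snd jk)) * norm x)) summable_on UNIV \<times> UNIV"
    using inner K(1) unfolding M_def[symmetric]
    by (intro summable_on_SigmaI[where g = "\<lambda>j. (K ^ j / fact j) * M"]) auto
  then have "(\<lambda>jk. norm (a jk)) summable_on UNIV \<times> UNIV"
    by (rule summable_on_comparison_test) (use a_bound in auto)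
  then have a_sum: "(a has_sum infsum a (UNIV \<times> UNIV)) (UNIV \<times> UNIV)"
    by (rule has_sum_infsum[OF abs_summable_summable])
  have row: "((\<lambda>k. a (j, k)) has_sum (T ^^ j) y /\<^sub>R fact j) UNIV" for j
  proof -
    have "bounded_linear (\<lambda>z. (T ^^ j) z /\<^sub>R fact j)"
      using bounded_linear_compose[OF bounded_linear_scaleR_right bounded_linear_funpow[OF T]] .
    from bounded_linear.sums[OF this op_exp_sums[OF Tm, of x]]
    have "(\<lambda>k. (T ^^ j) (((\<lambda>y. - T y) ^^ k) x /\<^sub>R fact k) /\<^sub>R fact j) sums ((T ^^ j) y /\<^sub>R fact j)"
      by (simp add: y_def)
    moreover have "(T ^^ j) (((\<lambda>y. - T y) ^^ k) x /\<^sub>R fact k) /\<^sub>R fact j = a (j, k)" for k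
      by (simp add: a_def pow_minus linear_scale[OF bounded_linear.linear[OF bounded_linear_funpow[OF T]]]
          funpow_add divide_inverse mult_ac)
    ultimately have "(\<lambda>k. a (j, k)) sums ((T ^^ j) y /\<^sub>R fact j)" by simp
    moreover have "summable (\<lambda>k. (K ^ j / fact j) * ((K ^ k / fact k) * norm x))"
      by (intro summable_mult summable_mult2 summable_real_exp)
    then have "summable (\<lambda>k. norm (a (j, k)))"
      by (rule summable_comparison_test') (use a_bound in simp)
    ultimately show ?thesis by (intro norm_summable_imp_has_sum)
  qed
  have "(\<lambda>j. (T ^^ j) y /\<^sub>R fact j) sums infsum a (UNIV \<times> UNIV)"
    by (rule has_sum_imp_sums, rule has_sum_SigmaD[OF a_sum]) (use row in auto)
  then have 1: "op_exp T y = infsum a (UNIV \<times> UNIV)"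
    using op_exp_sums[OF T] sums_unique2 by blast
  have diag: "(\<Sum>j\<le>n. a (j, n - j)) = (if n = 0 then x else 0)" for n
  proof -
    have "(\<Sum>j\<le>n. a (j, n - j)) = (\<Sum>j\<le>n. ((1 ^ j /\<^sub>R fact j) * ((-1) ^ (n - j) /\<^sub>R fact (n - j)) :: real)) *\<^sub>R (T ^^ n) x"
      by (simp add: a_def scaleR_sum_left divide_inverse mult_ac)
    also have "(\<Sum>j\<le>n. ((1 ^ j /\<^sub>R fact j) * ((-1) ^ (n - j) /\<^sub>R fact (n - j)) :: real)) = (1 + - 1) ^ n /\<^sub>R fact n"
      by (rule exp_series_add_commuting[symmetric]) simp
    finally show ?thesis by (simp add: power_0_left)
  qed
  have "((\<lambda>(n, j). a (j, n - j)) has_sum infsum a (UNIV \<times> UNIV)) (Sigma UNIV (\<lambda>n. {..n}))"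
    using a_sum
    by (subst has_sum_reindex_bij_witness[where i = "\<lambda>(j, k). (j + k, j)" and j = "\<lambda>(n, j). (j, n - j)"
          and T = "UNIV \<times> UNIV" and h = a and s' = "infsum a (UNIV \<times> UNIV)"]) auto
  then have "(\<lambda>n. \<Sum>j\<le>n. a (j, n - j)) sums infsum a (UNIV \<times> UNIV)"
    by (intro has_sum_imp_sums, elim has_sum_SigmaD) (auto intro: has_sum_finiteI)
  moreover have "(\<lambda>n. if n = 0 then x else 0) sums x" using sums_single[of 0 "\<lambda>_. x"] by simp
  ultimately have "infsum a (UNIV \<times> UNIV) = x" unfolding diag using sums_unique2 by blast
  with 1 show ?thesis by (simp add: y_def)
qed

lemma op_exp_first_order:
  fixes T :: "'a::banach \<Rightarrow> 'a"
  assumes T: "bounded_linear T"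
  obtains C where "C \<ge> 0" "\<And>t. \<bar>t\<bar> \<le> 1 \<Longrightarrow> norm (op_exp (\<lambda>y. t *\<^sub>R T y) x - x - t *\<^sub>R T x) \<le> C * t\<^sup>2"
proof -
  define f where "f n = (T ^^ n) x /\<^sub>R fact n" for n
  have sf: "summable (\<lambda>n. norm (f (n + 2)))"
    using op_exp_summable_norm[OF T] by (subst summable_iff_shift) (simp add: f_def)
  show ?thesis
  proof (rule that)
    show "0 \<le> (\<Sum>n. norm (f (n + 2)))" using sf by (rule suminf_nonneg) simp
    fix t :: real assume t: "\<bar>t\<bar> \<le> 1"
    have tT: "bounded_linear (\<lambda>y. t *\<^sub>R T y)"
      by (intro bounded_linear_compose[OF bounded_linear_scaleR_right] T)
    have pow: "((\<lambda>y. t *\<^sub>R T y) ^^ n) x /\<^sub>R fact n = t ^ n *\<^sub>R f n" for n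
    proof -
      have "((\<lambda>y. t *\<^sub>R T y) ^^ n) x = t ^ n *\<^sub>R (T ^^ n) x"
        by (induction n) (simp_all add: linear_scale[OF bounded_linear.linear[OF T]])
      then show ?thesis by (simp add: f_def mult.commute)
    qed
    have "(\<lambda>n. t ^ n *\<^sub>R f n) sums op_exp (\<lambda>y. t *\<^sub>R T y) x"
      using op_exp_sums[OF tT, of x] unfolding pow .
    then have "(\<lambda>n. t ^ (n + 2) *\<^sub>R f (n + 2)) sums (op_exp (\<lambda>y. t *\<^sub>R T y) x - (\<Sum>n<2. t ^ n *\<^sub>R f n))"
      by (rule sums_split_initial_segment)
    then have s: "(\<lambda>n. t ^ (n + 2) *\<^sub>R f (n + 2)) sums (op_exp (\<lambda>y. t *\<^sub>R T y) x - x - t *\<^sub>R T x)"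
      by (simp add: numeral_2_eq_2 f_def diff_diff_eq)
    have le: "norm (t ^ (n + 2) *\<^sub>R f (n + 2)) \<le> t\<^sup>2 * norm (f (n + 2))" for n
    proof -
      have "\<bar>t\<bar> ^ (n + 2) \<le> \<bar>t\<bar> ^ 2" using t by (intro power_decreasing) auto
      then have "\<bar>t\<bar> ^ (n + 2) * norm (f (n + 2)) \<le> t\<^sup>2 * norm (f (n + 2))"
        by (intro mult_right_mono) auto
      then show ?thesis by (simp only: norm_scaleR power_abs)
    qed
    have "norm (\<Sum>n. t ^ (n + 2) *\<^sub>R f (n + 2)) \<le> (\<Sum>n. t\<^sup>2 * norm (f (n + 2)))"
      using le summable_mult[OF sf] by (intro norm_suminf_le) auto
    also have "\<dots> = t\<^sup>2 * (\<Sum>n. norm (f (n + 2)))" using sf by (rule suminf_mult)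
    finally show "norm (op_exp (\<lambda>y. t *\<^sub>R T y) x - x - t *\<^sub>R T x) \<le> (\<Sum>n. norm (f (n + 2))) * t\<^sup>2"
      using sums_unique[OF s] by (simp add: mult.commute)
  qed
qed

lemma op_exp_scaleC:
  fixes T :: "'a::complex_banach \<Rightarrow> 'a"
  assumes T: "bounded_clinear T"
  shows "op_exp T (c *\<^sub>C x) = c *\<^sub>C op_exp T x"
proof (rule sums_unique2[OF op_exp_sums])
  have pow: "(T ^^ n) (c *\<^sub>C x) = c *\<^sub>C (T ^^ n) x" for n
    using T by (induction n) (simp_all add: bounded_clinear_def)
  show "bounded_linear T" using T by (simp add: bounded_clinear_def)
  from bounded_linear.sums[OF bounded_linear_scaleC op_exp_sums[OF this]]
  show "(\<lambda>n. (T ^^ n) (c *\<^sub>C x) /\<^sub>R fact n) sums (c *\<^sub>C op_exp T x)"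
    by (simp add: pow scaleR_scaleC mult.commute)
qed

section \<open>Square roots of \<open>1 - C\<close> for contractions \<open>C\<close>\<close>

text \<open>
  The iteration \<open>Q \<mapsto> (C + Q\<^sup>2) / 2\<close> started at 0. Its limit \<open>Q\<close> satisfies \<open>(1 - Q)\<^sup>2 = 1 - C\<close>.
\<close>

primrec sqrt_iter :: "('a::real_normed_vector \<Rightarrow>\<^sub>L 'a) \<Rightarrow> nat \<Rightarrow> 'a \<Rightarrow>\<^sub>L 'a" where
  "sqrt_iter C 0 = 0"
| "sqrt_iter C (Suc n) = (1/2) *\<^sub>R (C + (sqrt_iter C n o\<^sub>L sqrt_iter C n))"

text \<open>
  The same iteration for the number 1. Its increments dominate those of the operator iteration
  whenever \<open>\<parallel>C\<parallel> \<le> 1\<close>.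
\<close>

primrec sqrt_majorant :: "nat \<Rightarrow> real" where
  "sqrt_majorant 0 = 0"
| "sqrt_majorant (Suc n) = (1 + (sqrt_majorant n)\<^sup>2) / 2"

lemma sqrt_majorant_bounds: "0 \<le> sqrt_majorant n \<and> sqrt_majorant n \<le> 1"
proof (induction n)
  case (Suc n)
  then have "(sqrt_majorant n)\<^sup>2 \<le> 1" by (simp add: power_le_one)
  then show ?case by simp
qed simp

lemma sqrt_majorant_mono: "sqrt_majorant n \<le> sqrt_majorant (Suc n)"
proof -
  have "0 \<le> (1 - sqrt_majorant n)\<^sup>2" by simp
  then show ?thesis by (simp add: power2_eq_square algebra_simps)
qed

lemma sqrt_iter_commute:
  assumes "D o\<^sub>L C = C o\<^sub>L D"
  shows "D o\<^sub>L sqrt_iter C n = sqrt_iter C n o\<^sub>L D"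
proof -
  have C: "D (C x) = C (D x)" for x using assms by (metis blinfun_apply_blinfun_compose)
  have "D (sqrt_iter C n x) = sqrt_iter C n (D x)" for x
    by (induction n arbitrary: x) (simp_all add: blinfun.bilinear_simps C)
  then show ?thesis by (intro blinfun_eqI) simp
qed

lemma sqrt_iter_bound:
  assumes "norm C \<le> 1"
  shows "norm (sqrt_iter C n) \<le> sqrt_majorant n"
proof (induction n)
  case (Suc n)
  have "norm (C + (sqrt_iter C n o\<^sub>L sqrt_iter C n)) \<le> norm C + norm (sqrt_iter C n) * norm (sqrt_iter C n)"
    by (rule order_trans[OF norm_triangle_ineq add_left_mono[OF norm_blinfun_compose]])
  also have "\<dots> \<le> 1 + sqrt_majorant n * sqrt_majorant n"
    using assms Suc sqrt_majorant_bounds by (intro add_mono mult_mono) auto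
  finally show ?case by (simp add: power2_eq_square)
qed simp

lemma sqrt_iter_step:
  assumes "norm C \<le> 1"
  shows "norm (sqrt_iter C (Suc n) - sqrt_iter C n) \<le> sqrt_majorant (Suc n) - sqrt_majorant n"
proof (induction n)
  case 0
  then show ?case using assms by simp
next
  case (Suc n)
  let ?Q = "sqrt_iter C" and ?r = sqrt_majorant
  have CQ: "C o\<^sub>L ?Q m = ?Q m o\<^sub>L C" for m by (rule sqrt_iter_commute) simp
  have QQ: "?Q m (?Q n x) = ?Q n (?Q m x)" for m n x
    using sqrt_iter_commute[of "?Q m" C n] CQ by (metis blinfun_apply_blinfun_compose)
  \<comment> \<open>All iterates commute, so the difference of the squares factors.\<close>
  have "?Q (Suc (Suc n)) - ?Q (Suc n) = (1/2) *\<^sub>R ((?Q (Suc n) + ?Q n) o\<^sub>L (?Q (Suc n) - ?Q n))"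
  proof (rule blinfun_eqI)
    fix x
    have "?Q (Suc m) x = (1/2) *\<^sub>R (C x + ?Q m (?Q m x))" for m
      by (simp add: blinfun.bilinear_simps)
    from arg_cong2[where f = minus, OF this[of "Suc n"] this[of n]]
    have "?Q (Suc (Suc n)) x - ?Q (Suc n) x = (1/2) *\<^sub>R (?Q (Suc n) (?Q (Suc n) x) - ?Q n (?Q n x))"
      by (simp only: scaleR_diff_right[symmetric]) simp
    then show "(?Q (Suc (Suc n)) - ?Q (Suc n)) x = ((1/2) *\<^sub>R ((?Q (Suc n) + ?Q n) o\<^sub>L (?Q (Suc n) - ?Q n))) x"
      by (simp add: blinfun.bilinear_simps QQ[of "Suc n" n] del: sqrt_iter.simps)
  qed
  then have "norm (?Q (Suc (Suc n)) - ?Q (Suc n)) \<le> (1/2) * (norm (?Q (Suc n) + ?Q n) * norm (?Q (Suc n) - ?Q n))"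
    using norm_blinfun_compose[of "?Q (Suc n) + ?Q n" "?Q (Suc n) - ?Q n"]
      by (simp del: sqrt_iter.simps)
  also have "\<dots> \<le> (1/2) * ((?r (Suc n) + ?r n) * (?r (Suc n) - ?r n))"
    using sqrt_iter_bound[OF assms] Suc sqrt_majorant_bounds
    by (intro mult_left_mono mult_mono norm_triangle_mono add_nonneg_nonneg) (auto simp del: sqrt_iter.simps sqrt_majorant.simps)
  also have "\<dots> = ?r (Suc (Suc n)) - ?r (Suc n)"
    using arg_cong2[where f = minus, OF sqrt_majorant.simps(2)[of "Suc n"] sqrt_majorant.simps(2)[of n]]
    by (simp add: power2_eq_square field_simps del: sqrt_majorant.simps)
  finally show ?case .
qed

lemma sqrt_iter_Cauchy_bound:
  assumes "norm C \<le> 1" "n \<le> m"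
  shows "norm (sqrt_iter C m - sqrt_iter C n) \<le> sqrt_majorant m - sqrt_majorant n"
  using assms(2)
proof (induction m rule: dec_induct)
  case (step m)
  have "norm (sqrt_iter C (Suc m) - sqrt_iter C n) \<le>
      norm (sqrt_iter C (Suc m) - sqrt_iter C m) + norm (sqrt_iter C m - sqrt_iter C n)"
    using norm_triangle_ineq[of "sqrt_iter C (Suc m) - sqrt_iter C m" "sqrt_iter C m - sqrt_iter C n"]
    by (simp del: sqrt_iter.simps)
  with sqrt_iter_step[OF assms(1), of m] step.IH show ?case by linarith
qed simp

lemma sqrt_majorant_convergent:
  obtains \<rho> where "sqrt_majorant \<longlonglongrightarrow> \<rho>" "\<And>n. sqrt_majorant n \<le> \<rho>"
proof (rule incseq_convergent)
  show "incseq sqrt_majorant" using sqrt_majorant_mono by (rule incseq_SucI)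
  show "\<forall>i. sqrt_majorant i \<le> 1" using sqrt_majorant_bounds by blast
qed (use that in blast)

text \<open>
  The square root of \<open>1 - C\<close>; meaningful for \<open>\<parallel>C\<parallel> \<le> 1\<close>.
\<close>

definition sqrt_id_minus :: "('a::banach \<Rightarrow>\<^sub>L 'a) \<Rightarrow> 'a \<Rightarrow>\<^sub>L 'a" where
  "sqrt_id_minus C = id_blinfun - lim (sqrt_iter C)"

lemma uniform_limit_sqrt_iter:
  "uniform_limit (cball 0 1) (\<lambda>n (C :: 'a::banach \<Rightarrow>\<^sub>L 'a). id_blinfun - sqrt_iter C n) sqrt_id_minus sequentially"
proof (rule uniform_limitI)
  fix \<epsilon> :: real assume "\<epsilon> > 0"
  obtain \<rho> where \<rho>: "sqrt_majorant \<longlonglongrightarrow> \<rho>" "\<And>n. sqrt_majorant n \<le> \<rho>"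
    by (rule sqrt_majorant_convergent) blast
  have "eventually (\<lambda>n. dist (sqrt_majorant n) \<rho> < \<epsilon>) sequentially"
    using \<rho>(1) \<open>\<epsilon> > 0\<close> by (rule tendstoD)
  then show "\<forall>\<^sub>F n in sequentially. \<forall>C\<in>(cball 0 1 :: ('a \<Rightarrow>\<^sub>L 'a) set). dist (id_blinfun - sqrt_iter C n) (sqrt_id_minus C) < \<epsilon>"
  proof eventually_elim
    case (elim n)
    show ?case
    proof
      fix C :: "'a \<Rightarrow>\<^sub>L 'a" assume "C \<in> cball 0 1"
      then have C: "norm C \<le> 1" by simp
      have "Cauchy (sqrt_iter C)"
      proof (rule metric_CauchyI)
        fix e :: real assume "e > 0"
        obtain N where N: "\<And>n. n \<ge> N \<Longrightarrow> dist (sqrt_majorant n) \<rho> < e"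
          using tendstoD[OF \<rho>(1) \<open>e > 0\<close>] by (auto simp: eventually_sequentially)
        have *: "dist (sqrt_iter C m) (sqrt_iter C k) < e" if "N \<le> k" "k \<le> m" for m k
          using sqrt_iter_Cauchy_bound[OF C that(2)] N[OF that(1)] \<rho>(2)[of m] \<rho>(2)[of k]
            by (simp add: dist_norm)
        show "\<exists>N. \<forall>m\<ge>N. \<forall>k\<ge>N. dist (sqrt_iter C m) (sqrt_iter C k) < e"
          using * by (metis dist_commute nle_le)
      qed
      then have lim: "sqrt_iter C \<longlonglongrightarrow> lim (sqrt_iter C)"
        by (rule Cauchy_convergent[THEN convergent_LIMSEQ_iff[THEN iffD1]])
      have "norm (lim (sqrt_iter C) - sqrt_iter C n) \<le> \<rho> - sqrt_majorant n"
      proof (rule tendsto_upperbound)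
        show "(\<lambda>m. norm (sqrt_iter C m - sqrt_iter C n)) \<longlonglongrightarrow> norm (lim (sqrt_iter C) - sqrt_iter C n)"
          by (intro tendsto_intros lim)
        have "norm (sqrt_iter C m - sqrt_iter C n) \<le> \<rho> - sqrt_majorant n" if "n \<le> m" for m
          using sqrt_iter_Cauchy_bound[OF C that] \<rho>(2)[of m] by linarith
        then show "\<forall>\<^sub>F m in sequentially. norm (sqrt_iter C m - sqrt_iter C n) \<le> \<rho> - sqrt_majorant n"
          by (rule eventually_sequentiallyI)
      qed simp
      then show "dist (id_blinfun - sqrt_iter C n) (sqrt_id_minus C) < \<epsilon>"
        using elim \<rho>(2)[of n] by (simp add: sqrt_id_minus_def dist_norm)
    qed
  qed
qed

lemma sqrt_iter_tendsto:
  assumes "norm C \<le> 1"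
  shows "(\<lambda>n. id_blinfun - sqrt_iter C n) \<longlonglongrightarrow> sqrt_id_minus C"
  using tendsto_uniform_limitI[OF uniform_limit_sqrt_iter, of C] assms by simp

lemma continuous_on_sqrt_id_minus: "continuous_on (cball 0 1) sqrt_id_minus"
proof (rule uniform_limit_theorem[OF _ uniform_limit_sqrt_iter])
  have "continuous_on UNIV (\<lambda>C. sqrt_iter C n)" for n
    by (induction n) (auto intro!: continuous_intros bounded_bilinear.continuous_on[OF bounded_bilinear_blinfun_compose])
  then show "\<forall>\<^sub>F n in sequentially. continuous_on (cball 0 1) (\<lambda>C. id_blinfun - sqrt_iter C n)"
    by (intro always_eventually allI continuous_intros) (rule continuous_on_subset, auto)
qed simp

lemma sqrt_id_minus_square:
  assumes "norm C \<le> 1"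
  shows "sqrt_id_minus C o\<^sub>L sqrt_id_minus C = id_blinfun - C"
proof (rule LIMSEQ_unique)
  note lim = sqrt_iter_tendsto[OF assms]
  show "(\<lambda>n. (id_blinfun - sqrt_iter C n) o\<^sub>L (id_blinfun - sqrt_iter C n))
      \<longlonglongrightarrow> (sqrt_id_minus C o\<^sub>L sqrt_id_minus C)"
    by (intro bounded_bilinear.tendsto[OF bounded_bilinear_blinfun_compose] lim)
  have eq: "(id_blinfun - sqrt_iter C n) o\<^sub>L (id_blinfun - sqrt_iter C n) =
    id_blinfun - C + 2 *\<^sub>R ((id_blinfun - sqrt_iter C n) - (id_blinfun - sqrt_iter C (Suc n)))" for n
    by (rule blinfun_eqI) (simp add: blinfun.bilinear_simps scaleR_2 algebra_simps)
  have "(\<lambda>n. id_blinfun - C + 2 *\<^sub>R ((id_blinfun - sqrt_iter C n) - (id_blinfun - sqrt_iter C (Suc n))))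
      \<longlonglongrightarrow> id_blinfun - C + 2 *\<^sub>R (sqrt_id_minus C - sqrt_id_minus C)"
    by (intro tendsto_intros lim LIMSEQ_Suc[OF lim])
  then show "(\<lambda>n. (id_blinfun - sqrt_iter C n) o\<^sub>L (id_blinfun - sqrt_iter C n)) \<longlonglongrightarrow> (id_blinfun - C)"
    unfolding eq by simp
qed

lemma sqrt_id_minus_commute:
  assumes "norm C \<le> 1" "D o\<^sub>L C = C o\<^sub>L D"
  shows "D o\<^sub>L sqrt_id_minus C = sqrt_id_minus C o\<^sub>L D"
proof (rule LIMSEQ_unique)
  note lim = sqrt_iter_tendsto[OF assms(1)]
  show "(\<lambda>n. D o\<^sub>L (id_blinfun - sqrt_iter C n)) \<longlonglongrightarrow> (D o\<^sub>L sqrt_id_minus C)"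
    by (intro bounded_bilinear.tendsto[OF bounded_bilinear_blinfun_compose] lim tendsto_const)
  have eq: "D o\<^sub>L (id_blinfun - sqrt_iter C n) = (id_blinfun - sqrt_iter C n) o\<^sub>L D" for n
  proof (rule blinfun_eqI)
    fix x
    have "D (sqrt_iter C n x) = sqrt_iter C n (D x)"
      using sqrt_iter_commute[OF assms(2), of n] by (metis blinfun_apply_blinfun_compose)
    then show "(D o\<^sub>L (id_blinfun - sqrt_iter C n)) x = ((id_blinfun - sqrt_iter C n) o\<^sub>L D) x"
      by (simp add: blinfun.bilinear_simps)
  qed
  show "(\<lambda>n. D o\<^sub>L (id_blinfun - sqrt_iter C n)) \<longlonglongrightarrow> (sqrt_id_minus C o\<^sub>L D)"
    unfolding eq
    by (intro bounded_bilinear.tendsto[OF bounded_bilinear_blinfun_compose] lim tendsto_const)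
qed

text \<open>
  In the intended case \<open>A c\<close> is \<open>cos (H + c)\<close> for a hermitian \<open>H\<close>, so that \<open>A (c + \<pi>/2)\<close> is
  \<open>- sin (H + c)\<close> and the square root is \<open>\<bar>sin (H + c)\<bar>\<close>. If at each angle the positive or the
  negative part of \<open>sin (H + c)\<close> kills \<open>x\<close>, then both do at some angle: the two closed sets of
  angles cover the line and are translates of each other by \<open>\<pi>\<close>.
\<close>

theorem common_zero_of_rotation:
  fixes P Q :: "'a::banach \<Rightarrow>\<^sub>L 'a"
  defines "A \<equiv> \<lambda>c. cos c *\<^sub>R P + sin c *\<^sub>R Q"
  assumes norm: "\<And>c. norm (A c) \<le> 1"
    and prime: "\<And>c. (sqrt_id_minus (A c o\<^sub>L A c) + A (c + pi/2)) x = 0 \<or>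
       (sqrt_id_minus (A c o\<^sub>L A c) - A (c + pi/2)) x = 0"
  shows "\<exists>c. A c x = 0"
proof -
  define R where "R c = sqrt_id_minus (A c o\<^sub>L A c) x" for c
  define S where "S c = A (c + pi/2) x" for c
  have contA: "continuous_on UNIV A" unfolding A_def by (intro continuous_intros)
  have "A c o\<^sub>L A c \<in> cball 0 1" for c
    using norm_blinfun_compose[of "A c" "A c"] mult_mono[OF norm norm, of c c] by simp
  then have "continuous_on UNIV (\<lambda>c. sqrt_id_minus (A c o\<^sub>L A c))"
    using continuous_on_compose2[OF continuous_on_sqrt_id_minus
        bounded_bilinear.continuous_on[OF bounded_bilinear_blinfun_compose contA contA]] by blast
  then have contR: "continuous_on UNIV R" unfolding R_def by (intro continuous_intros)
  have contS: "continuous_on UNIV S"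
    unfolding S_def by (intro continuous_intros continuous_on_compose2[OF contA]) auto
  have Api: "A (c + pi) = - A c" for c by (simp add: A_def)
  have shift: "R (c + pi) = R c" "S (c + pi) = - S c" for c
  proof -
    have "A (c + pi) o\<^sub>L A (c + pi) = A c o\<^sub>L A c"
      unfolding Api by (rule blinfun_eqI) (simp add: blinfun.bilinear_simps)
    then show "R (c + pi) = R c" by (simp add: R_def)
    show "S (c + pi) = - S c"
      using Api[of "c + pi/2"]
        by (simp add: S_def add.commute add.left_commute blinfun.bilinear_simps)
  qed
  define X where "X = {c. R c + S c = 0}"
  define Y where "Y = {c. R c - S c = 0}"
  have "closed X" "closed Y" unfolding X_def Y_def
    by (intro closed_Collect_eq continuous_intros contR contS)+
  moreover have XY: "UNIV \<subseteq> X \<union> Y"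
    using prime by (auto simp: X_def Y_def R_def S_def blinfun.bilinear_simps)
  moreover have "c \<in> X \<Longrightarrow> c + pi \<in> Y" "c \<in> Y \<Longrightarrow> c + pi \<in> X" for c
    unfolding X_def Y_def mem_Collect_eq shift by simp_all
  then have "X \<inter> UNIV \<noteq> {}" "Y \<inter> UNIV \<noteq> {}" using XY by blast+
  ultimately have "X \<inter> Y \<inter> UNIV \<noteq> {}"
    using connected_closedD[OF connected_UNIV, of X Y] by blast
  then obtain c where "R c + S c = 0" "R c - S c = 0" by (auto simp: X_def Y_def)
  then have "S c = 0"
    by (metis add_cancel_right_left diff_0_right eq_iff_diff_eq_0 scaleR_2 scaleR_eq_0_iff zero_neq_numeral)
  then show ?thesis by (auto simp: S_def)
qed

section \<open>Adjoints on the closed span of the odd powers of an element\<close>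

lemma subspace_closure:
  fixes S :: "'a::real_normed_vector set"
  assumes S: "subspace S"
  shows "subspace (closure S)"
proof (rule subspaceI)
  show "0 \<in> closure S" using subspace_0[OF S] closure_subset by blast
  show "x + y \<in> closure S" if xy: "x \<in> closure S" "y \<in> closure S" for x y
  proof -
    obtain f g where "\<And>n. f n \<in> S" "f \<longlonglongrightarrow> x" "\<And>n. g n \<in> S" "g \<longlonglongrightarrow> y"
      using xy unfolding closure_sequential by metis
    then have "(\<lambda>n. f n + g n) \<longlonglongrightarrow> x + y" "\<And>n. f n + g n \<in> S"
      using S by (auto intro: tendsto_add subspace_add)
    then show ?thesis unfolding closure_sequential by (intro exI[of _ "\<lambda>n. f n + g n"]) simp
  qed
  show "r *\<^sub>R x \<in> closure S" if x: "x \<in> closure S" for r x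
  proof -
    obtain f where "\<And>n. f n \<in> S" "f \<longlonglongrightarrow> x" using x unfolding closure_sequential by metis
    then have "(\<lambda>n. r *\<^sub>R f n) \<longlonglongrightarrow> r *\<^sub>R x" "\<And>n. r *\<^sub>R f n \<in> S"
      using S by (auto intro: tendsto_scaleR subspace_scale)
    then show ?thesis unfolding closure_sequential by (intro exI[of _ "\<lambda>n. r *\<^sub>R f n"]) simp
  qed
qed

lemma bounded_linear_image_closure_span:
  assumes "bounded_linear f" "f ` S \<subseteq> span S"
  shows "f ` closure (span S) \<subseteq> closure (span S)"
proof -
  have "f ` closure (span S) \<subseteq> closure (f ` span S)"
    by (rule closure_bounded_linear_image_subset[OF assms(1)])
  also have "f ` span S = span (f ` S)"
    using linear_span_image[OF bounded_linear.linear[OF assms(1)]] by simp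
  also have "closure (span (f ` S)) \<subseteq> closure (span S)"
    by (intro closure_mono span_minimal assms(2) subspace_span)
  finally show ?thesis .
qed

context jb_star_triple
begin

text \<open>
  \<open>L(x\<^sub>m, x\<^sub>n)\<close> depends only on \<open>m + n\<close>, where \<open>x\<^sub>n = L(x,x)\<^sup>n x\<close>. By induction on \<open>m + n\<close>: two
  instances of the Jordan identity show that passing from \<open>(m, n + 1)\<close> to \<open>(m + 1, n)\<close> always
  adds the same operator \<open>\<kappa>\<close>, while \<open>\<kappa>\<close> is by definition minus the sum of all these increments.
\<close>

lemma tp_powers_shift:
  "tp ((tp x x ^^ m) x) ((tp x x ^^ n) x) z = tp ((tp x x ^^ (m + n)) x) x z"
proof -
  define X where "X n = (tp x x ^^ n) x" for n
  have X0: "X 0 = x" and XS: "tp x x (X n) = X (Suc n)" for n by (simp_all add: X_def)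
  define D where "D m n z = tp (X m) (X n) z" for m n z
  have "D m n z = D (m + n) 0 z" for m n z
  proof (induction "m + n" arbitrary: m n z)
    case 0
    then show ?case by simp
  next
    case (Suc N)
    have IH: "D i j u = D N 0 u" if "i + j = N" for i j u
      using Suc(1)[of i j] that by simp
    have Dx: "D i j x = X (Suc N)" if "i + j = N" for i j
      using IH[OF that, of x] tp_commute[of "X N" x x] by (simp add: D_def X0 XS)
    have D0: "D i j (tp x x z) = tp x x (D i j z) + D (Suc N) 0 z - D 0 (Suc N) z" if "i + j = N" for i j
      using jordan_identity[of "X i" "X j" x x z] Dx[OF that] Dx[of j i] that
      by (simp add: D_def X0 add.commute)
    define \<kappa> where "\<kappa> = D 0 (Suc N) z - D (Suc N) 0 z"
    have step: "D (Suc i) j z = D i (Suc j) z + \<kappa>" if "i + j = N" for i j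
    proof -
      have "D (Suc i) j z = D i (Suc j) z + (tp x x (D i j z) - D i j (tp x x z))"
        using jordan_identity[of x x "X i" "X j" z] by (simp add: D_def XS algebra_simps)
      moreover have "tp x x (D i j z) - D i j (tp x x z) = \<kappa>" by (simp add: D0[OF that] \<kappa>_def)
      ultimately show ?thesis by simp
    qed
    have arith: "D i (Suc N - i) z = D 0 (Suc N) z + real i *\<^sub>R \<kappa>" if "i \<le> Suc N" for i
      using that
    proof (induction i)
      case (Suc i)
      then show ?case
        using step[of i "N - i"] by (simp add: Suc_diff_le scaleR_left_distrib algebra_simps)
    qed simp
    have last: "D (Suc N) 0 z = D 0 (Suc N) z + real (Suc N) *\<^sub>R \<kappa>"
      using arith[of "Suc N"] by (simp only: diff_self_eq_0 order_refl)
    have "\<kappa> = D 0 (Suc N) z - D (Suc N) 0 z" by (rule \<kappa>_def)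
    also have "\<dots> = - (real (Suc N) *\<^sub>R \<kappa>)" by (subst last) simp
    finally have "real (Suc N) *\<^sub>R \<kappa> + \<kappa> = 0" by (metis neg_eq_iff_add_eq_0 add.commute)
    then have "(real (Suc N) + 1) *\<^sub>R \<kappa> = 0" by (simp only: scaleR_left_distrib scaleR_one)
    then have "\<kappa> = 0" by simp
    then have *: "D i (Suc N - i) z = D 0 (Suc N) z" if "i \<le> Suc N" for i using arith[OF that] by simp
    have "n = Suc N - m" "m \<le> Suc N" using Suc(2) by auto
    then show ?case using *[of m] *[of "Suc N"] Suc(2) by simp
  qed
  then show ?thesis by (simp add: D_def X_def)
qed

lemma tp_zero: "tp 0 b c = 0" "tp a 0 c = 0" "tp a b 0 = 0"
  by (rule linear_0[OF linear_tp_left] linear_0[OF linear_tp_middle] linear_0[OF linear_tp_right])+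

lemma tendsto_tp:
  assumes "(f \<longlongrightarrow> a) F" "(g \<longlongrightarrow> b) F"
  shows "((\<lambda>n. tp (f n) (g n) z) \<longlongrightarrow> tp a b z) F"
proof -
  have "isCont (\<lambda>(a, b, c). tp a b c) (a, b, z)"
    using continuous_tp by (simp add: continuous_on_eq_continuous_at)
  from isCont_tendsto_compose[OF this tendsto_Pair[OF assms(1) tendsto_Pair[OF assms(2) tendsto_const]]]
  show ?thesis by simp
qed

text \<open>
  Orthogonality is symmetric.
\<close>

lemma tp_swap_eq_0:
  assumes "\<And>z. tp a b z = 0"
  shows "tp b a z = 0"
proof -
  have "tp x (tp b a y) z = 0" for x y z
    using jordan_identity[of a b x y z] assms by (simp add: tp_zero)
  then have "norm (tp b a z) ^ 3 = 0" using norm_cube[of "tp b a z"] by simp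
  then show ?thesis by simp
qed

text \<open>
  Both operators leave \<open>M\<close> invariant, and \<open>P\<close> in the first variable of the triple product can be
  traded for \<open>P'\<close> in the second one as long as both arguments lie in \<open>M\<close>.
\<close>

definition adjoint_on :: "'e set \<Rightarrow> ('e \<Rightarrow> 'e) \<Rightarrow> ('e \<Rightarrow> 'e) \<Rightarrow> bool" where
  "adjoint_on M P P' \<longleftrightarrow>
    (\<forall>a\<in>M. P a \<in> M \<and> P' a \<in> M) \<and> (\<forall>a\<in>M. \<forall>b\<in>M. \<forall>z. tp (P a) b z = tp a (P' b) z)"

lemma adjoint_on_ident: "adjoint_on M (\<lambda>a. a) (\<lambda>a. a)"
  by (simp add: adjoint_on_def)

lemma adjoint_on_compose:
  assumes "adjoint_on M P P'" "adjoint_on M Q Q'"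
  shows "adjoint_on M (\<lambda>a. P (Q a)) (\<lambda>a. Q' (P' a))"
  using assms by (simp add: adjoint_on_def)

lemma adjoint_on_add:
  assumes "subspace M" "adjoint_on M P P'" "adjoint_on M Q Q'"
  shows "adjoint_on M (\<lambda>a. P a + Q a) (\<lambda>a. P' a + Q' a)"
  using assms by (simp add: adjoint_on_def subspace_add tp_add_left tp_add_middle)

lemma adjoint_on_scaleC:
  assumes "\<And>c a. a \<in> M \<Longrightarrow> c *\<^sub>C a \<in> M" "adjoint_on M P P'"
  shows "adjoint_on M (\<lambda>a. c *\<^sub>C P a) (\<lambda>a. cnj c *\<^sub>C P' a)"
  using assms by (simp add: adjoint_on_def tp_scaleC_left tp_scaleC_middle)

lemma adjoint_on_scaleR:
  assumes "subspace M" "adjoint_on M P P'"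
  shows "adjoint_on M (\<lambda>a. r *\<^sub>R P a) (\<lambda>a. r *\<^sub>R P' a)"
  using assms by (simp add: adjoint_on_def subspace_scale tp_scaleR_left tp_scaleR_middle)

lemma adjoint_on_limit:
  assumes "closed M" "\<And>n. adjoint_on M (P n) (P' n)"
    and "\<And>a. a \<in> M \<Longrightarrow> (\<lambda>n. P n a) \<longlonglongrightarrow> Q a" "\<And>a. a \<in> M \<Longrightarrow> (\<lambda>n. P' n a) \<longlonglongrightarrow> Q' a"
  shows "adjoint_on M Q Q'"
  unfolding adjoint_on_def
proof (intro conjI ballI allI)
  show "Q a \<in> M" "Q' a \<in> M" if "a \<in> M" for a
    using assms(2) that closed_sequentially[OF assms(1) _ assms(3)[OF that]]
      closed_sequentially[OF assms(1) _ assms(4)[OF that]]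
    by (simp_all add: adjoint_on_def)
  show "tp (Q a) b z = tp a (Q' b) z" if "a \<in> M" "b \<in> M" for a b z
  proof (rule LIMSEQ_unique)
    show "(\<lambda>n. tp (P n a) b z) \<longlonglongrightarrow> tp (Q a) b z"
      by (intro tendsto_tp assms(3) that tendsto_const)
    show "(\<lambda>n. tp (P n a) b z) \<longlonglongrightarrow> tp a (Q' b) z"
      using tendsto_tp[OF tendsto_const assms(4)[OF that(2)]] assms(2) that
        by (simp add: adjoint_on_def)
  qed
qed

lemma adjoint_on_sum:
  fixes n :: nat
  assumes "subspace M" "\<And>k. adjoint_on M (P k) (P' k)"
  shows "adjoint_on M (\<lambda>a. \<Sum>k<n. P k a) (\<lambda>a. \<Sum>k<n. P' k a)"
proof (induction n)
  case 0
  then show ?case using assms(1) by (simp add: adjoint_on_def subspace_0 tp_zero)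
next
  case (Suc n)
  then show ?case using adjoint_on_add[OF assms(1) Suc assms(2)[of n]] by simp
qed

lemma adjoint_on_funpow:
  assumes "adjoint_on M P P'"
  shows "adjoint_on M (P ^^ n) (P' ^^ n)"
proof (induction n)
  case 0
  show ?case using adjoint_on_ident by (simp add: id_def)
next
  case (Suc n)
  have "(P' ^^ Suc n) = (\<lambda>a. (P' ^^ n) (P' a))" by (simp add: fun_eq_iff funpow_swap1)
  then show ?case using adjoint_on_compose[OF assms Suc] by (simp add: o_def)
qed

lemma adjoint_on_op_exp:
  assumes M: "subspace M" "closed M" and adj: "adjoint_on M T T'"
    and bl: "bounded_linear T" "bounded_linear T'"
  shows "adjoint_on M (op_exp T) (op_exp T')"
proof (rule adjoint_on_limit[OF M(2)])
  show "adjoint_on M (\<lambda>a. \<Sum>k<n. (T ^^ k) a /\<^sub>R fact k) (\<lambda>a. \<Sum>k<n. (T' ^^ k) a /\<^sub>R fact k)" for n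
    by (intro adjoint_on_sum adjoint_on_scaleR M adjoint_on_funpow adj)
qed (use op_exp_sums[OF bl(1)] op_exp_sums[OF bl(2)] in \<open>auto simp: sums_def\<close>)

lemma adjoint_on_sqrt:
  assumes M: "subspace M" "closed M" and C: "norm C \<le> 1" and adj: "adjoint_on M (blinfun_apply C) (blinfun_apply C)"
  shows "adjoint_on M (blinfun_apply (sqrt_id_minus C)) (blinfun_apply (sqrt_id_minus C))"
proof (rule adjoint_on_limit[OF M(2)])
  have Q: "adjoint_on M (blinfun_apply (sqrt_iter C n)) (blinfun_apply (sqrt_iter C n))" for n
  proof (induction n)
    case 0
    show ?case using M(1) by (simp add: adjoint_on_def subspace_0 tp_zero)
  next
    case (Suc n)
    have "adjoint_on M (\<lambda>a. (1/2) *\<^sub>R (C a + sqrt_iter C n (sqrt_iter C n a))) (\<lambda>a. (1/2) *\<^sub>R (C a + sqrt_iter C n (sqrt_iter C n a)))"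
      by (rule adjoint_on_scaleR[OF M(1) adjoint_on_add[OF M(1) adj adjoint_on_compose[OF Suc Suc]]])
    then show ?case by (simp add: blinfun.bilinear_simps)
  qed
  show "adjoint_on M (\<lambda>a. a + (-1) *\<^sub>R sqrt_iter C n a) (\<lambda>a. a + (-1) *\<^sub>R sqrt_iter C n a)" for n
    by (rule adjoint_on_add[OF M(1) adjoint_on_ident adjoint_on_scaleR[OF M(1) Q]])
  show "(\<lambda>n. a + (-1) *\<^sub>R sqrt_iter C n a) \<longlonglongrightarrow> sqrt_id_minus C a" for a
    using blinfun.tendsto[OF sqrt_iter_tendsto[OF C] tendsto_const[of a]]
      by (simp add: blinfun.bilinear_simps)
  then show "(\<lambda>n. a + (-1) *\<^sub>R sqrt_iter C n a) \<longlonglongrightarrow> sqrt_id_minus C a" for a .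
qed

text \<open>
  The closed complex subspace generated by the odd powers \<open>L(x,x)\<^sup>n x\<close> of \<open>x\<close>, written as the
  closure of a real span of complex multiples.
\<close>

definition cyclic_subspace :: "'e \<Rightarrow> 'e set" where
  "cyclic_subspace x = closure (span (range (\<lambda>(c, n). c *\<^sub>C (tp x x ^^ n) x)))"

lemma bounded_linear_tp_self: "bounded_linear (tp x x)"
  using hermitian[of x] by (simp add: hermitian_op_def bounded_clinear_def)

lemma cyclic_subspace:
  shows "subspace (cyclic_subspace x)" and "closed (cyclic_subspace x)" and "x \<in> cyclic_subspace x"
    and "a \<in> cyclic_subspace x \<Longrightarrow> c *\<^sub>C a \<in> cyclic_subspace x"
    and "adjoint_on (cyclic_subspace x) (tp x x) (tp x x)"
proof -
  define G where "G = range (\<lambda>(c, n). c *\<^sub>C (tp x x ^^ n) x)"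
  have M: "cyclic_subspace x = closure (span G)" by (simp add: cyclic_subspace_def G_def)
  show "subspace (cyclic_subspace x)" unfolding M by (intro subspace_closure subspace_span)
  show "closed (cyclic_subspace x)" unfolding M by simp
  have G: "c *\<^sub>C (tp x x ^^ n) x \<in> G" for c n unfolding G_def
    by (rule image_eqI[of _ _ "(c, n)"]) auto
  have "x \<in> G" using G[of 1 0] by simp
  then show "x \<in> cyclic_subspace x" unfolding M by (intro subsetD[OF closure_subset] span_base)
  have "(\<lambda>y. c *\<^sub>C y) ` closure (span G) \<subseteq> closure (span G)" for c
    by (rule bounded_linear_image_closure_span[OF bounded_linear_scaleC])
       (use G in \<open>auto simp: G_def intro!: span_base\<close>)
  then show "a \<in> cyclic_subspace x \<Longrightarrow> c *\<^sub>C a \<in> cyclic_subspace x" unfolding M by blast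
  have L: "tp x x (c *\<^sub>C (tp x x ^^ n) x) = c *\<^sub>C (tp x x ^^ Suc n) x" for c n
    by (simp add: tp_scaleC_right)
  have inv: "tp x x ` closure (span G) \<subseteq> closure (span G)"
    by (rule bounded_linear_image_closure_span[OF bounded_linear_tp_self])
       (use G L in \<open>auto simp: G_def intro!: span_base simp del: funpow.simps\<close>)
  have extend: "\<forall>a\<in>closure (span G). f a = g a"
    if "linear f" "linear g" "continuous_on UNIV f" "continuous_on UNIV g" "\<And>a. a \<in> G \<Longrightarrow> f a = g a"
    for f g :: "'e \<Rightarrow> 'e"
  proof -
    have "span G \<subseteq> {a. f a = g a}" using linear_eq_on[OF that(1,2)] that(5) by blast
    moreover have "closed {a. f a = g a}" by (intro closed_Collect_eq that)
    ultimately show ?thesis using closure_minimal by blast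
  qed
  have cont: "continuous_on UNIV f \<Longrightarrow> continuous_on UNIV g \<Longrightarrow> continuous_on UNIV (\<lambda>a. tp (f a) (g a) z)"
    for f g :: "'e \<Rightarrow> 'e" and z
    unfolding continuous_on_def by (intro ballI tendsto_tp) auto
  have contL: "continuous_on UNIV (tp x x)"
    using bounded_linear_tp_self by (rule linear_continuous_on)
  have linL: "linear (tp x x)" using bounded_linear_tp_self by (rule bounded_linear.linear)
  have GG: "tp (tp x x a) b z = tp a (tp x x b) z" if "a \<in> G" "b \<in> G" for a b z
  proof -
    obtain c m d n where "a = c *\<^sub>C (tp x x ^^ m) x" "b = d *\<^sub>C (tp x x ^^ n) x"
      using \<open>a \<in> G\<close> \<open>b \<in> G\<close> by (auto simp: G_def)
    then show ?thesis
      by (simp only: L tp_scaleC_left tp_scaleC_middle tp_powers_shift) simp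
  qed
  have "\<forall>b\<in>closure (span G). tp (tp x x a) b z = tp a (tp x x b) z" if "a \<in> G" for a z
    by (rule extend) (auto intro!: linear_tp_middle linear_compose[OF linL linear_tp_middle, unfolded o_def]
        cont continuous_intros contL GG that)
  then have "\<forall>a\<in>closure (span G). tp (tp x x a) b z = tp a (tp x x b) z" if "b \<in> closure (span G)" for b z
    by (intro extend) (use that in \<open>auto intro!: linear_tp_left linear_compose[OF linL linear_tp_left, unfolded o_def]
        cont continuous_intros contL\<close>)
  then show "adjoint_on (cyclic_subspace x) (tp x x) (tp x x)"
    unfolding adjoint_on_def M using inv by blast
qed

end

section \<open>Rank one\<close>

text \<open>
  If \<open>x\<close> and \<open>v\<close> were independent, then \<open>\<parallel>a x - b v\<parallel>\<close> would be at least a multiple of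
  \<open>\<parallel>(a, b)\<parallel>\<close>, hence at least of order \<open>t\<close> for \<open>(a, b) = (cos c, t sin c)\<close>.
\<close>

lemma eigenvector_from_approximation:
  fixes x v :: "'a::real_normed_vector"
  assumes x: "x \<noteq> 0"
    and approx: "\<And>t. 0 < t \<Longrightarrow> t \<le> 1 \<Longrightarrow> \<exists>c. norm (cos c *\<^sub>R x - (t * sin c) *\<^sub>R v) \<le> K * t\<^sup>2"
  shows "\<exists>\<kappa>. v = \<kappa> *\<^sub>R x"
proof (rule ccontr)
  assume no: "\<nexists>\<kappa>. v = \<kappa> *\<^sub>R x"
  define \<phi> where "\<phi> z = Re z *\<^sub>R v + Im z *\<^sub>R x" for z
  have lin: "bounded_linear \<phi>" unfolding \<phi>_def
    by (intro bounded_linear_add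
        bounded_linear_compose[OF bounded_linear_scaleR_left] bounded_linear_Re bounded_linear_Im)
  have inj: "z = 0" if "\<phi> z = 0" for z
  proof (cases "Re z = 0")
    case True
    with that x show ?thesis by (simp add: \<phi>_def complex_eq_iff)
  next
    case False
    from that have "Re z *\<^sub>R v = (- Im z) *\<^sub>R x" by (simp add: \<phi>_def eq_neg_iff_add_eq_0)
    then have "inverse (Re z) *\<^sub>R Re z *\<^sub>R v = (inverse (Re z) * - Im z) *\<^sub>R x" by simp
    with False have "v = (inverse (Re z) * - Im z) *\<^sub>R x" by simp
    with no show ?thesis by blast
  qed
  obtain B where B: "B > 0" "\<And>z. B * norm z \<le> norm (\<phi> z)"
    using inj_linear_bounded_below[OF lin inj] by blast
  have small: "B \<le> K * t" if t: "0 < t" "t \<le> 1" for t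
  proof -
    obtain c where c: "norm (cos c *\<^sub>R x - (t * sin c) *\<^sub>R v) \<le> K * t\<^sup>2" using approx[OF t] by blast
    define z where "z = Complex (- (t * sin c)) (cos c)"
    have "t\<^sup>2 * (cos c)\<^sup>2 \<le> 1 * (cos c)\<^sup>2" using t by (intro mult_right_mono power_le_one) auto
    then have "t\<^sup>2 * ((sin c)\<^sup>2 + (cos c)\<^sup>2) \<le> (t * sin c)\<^sup>2 + (cos c)\<^sup>2"
      by (simp add: distrib_left power_mult_distrib del: sin_cos_squared_add)
    then have "t \<le> norm z" unfolding z_def cmod_def by (intro real_le_rsqrt) simp
    then have "B * t \<le> B * norm z" using B(1) by simp
    also have "\<dots> \<le> norm (\<phi> z)" by (rule B(2))
    also have "\<phi> z = cos c *\<^sub>R x - (t * sin c) *\<^sub>R v" by (simp add: \<phi>_def z_def)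
    also note c
    finally show ?thesis using t(1) by (simp add: power2_eq_square)
  qed
  have K: "K > 0" using small[of 1] B(1) by simp
  have "B \<le> K * min 1 (B / (2 * K))" using B(1) K by (intro small) auto
  also have "\<dots> \<le> K * (B / (2 * K))" using K by (intro mult_left_mono) auto
  also have "\<dots> = B / 2" using K by simp
  finally show False using B(1) by simp
qed

text \<open>
  Triples without pairs of nonzero orthogonal elements.
\<close>

locale prime_jb_star_triple = jb_star_triple tp
  for tp :: "'e::complex_banach \<Rightarrow> 'e \<Rightarrow> 'e \<Rightarrow> 'e" +
  assumes prime: "(\<And>z. tp a b z = 0) \<Longrightarrow> a = 0 \<or> b = 0"
begin

text \<open>
  The vanishing sum is twice \<open>cos (tL(x,x) + c) x\<close>, since
  \<open>cos c (U + V) + i sin c (U - V)\<close> is twice \<open>cos (tL(x,x) + c)\<close> for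
  \<open>U = exp (itL(x,x))\<close>.
\<close>

lemma exp_rotation_has_zero:
  fixes x :: 'e and t :: real
  defines "U \<equiv> \<lambda>s. op_exp (\<lambda>y. (\<i> * complex_of_real s) *\<^sub>C tp x x y)"
  shows "\<exists>c. cos c *\<^sub>R (U t x + U (- t) x) + sin c *\<^sub>R (\<i> *\<^sub>C (U t x - U (- t) x)) = 0"
proof -
  let ?M = "cyclic_subspace x"
  note M = cyclic_subspace[where x = x]
  define T where "T s y = (\<i> * complex_of_real s) *\<^sub>C tp x x y" for s y
  have U: "U s = op_exp (T s)" for s by (simp add: U_def T_def[abs_def])
  have bT: "bounded_linear (T s)" for s
    unfolding T_def[abs_def]
      by (rule bounded_linear_compose[OF bounded_linear_scaleC bounded_linear_tp_self])
  then have cT: "bounded_clinear (T s)" for s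
    by (simp add: bounded_clinear_def) (simp add: T_def tp_scaleC_right mult.commute)
  have Tminus: "T (- s) = (\<lambda>y. - T s y)" for s by (simp add: T_def fun_eq_iff)
  have normU: "norm (U s y) = norm y" for s y
    using hermitian[of x] by (simp add: U_def hermitian_op_def)
  have addU: "U s (y + z) = U s y + U s z" for s y z unfolding U
    by (rule linear_add[OF linear_op_exp[OF bT]])
  have scaleU: "U s (c *\<^sub>C y) = c *\<^sub>C U s y" for s c y unfolding U by (rule op_exp_scaleC[OF cT])
  have inv: "U s (U (- s) y) = y" for s y
    using op_exp_minus_inverse[OF bT[of s]] by (simp add: U Tminus)
  have UV: "U t (U (- t) y) = y" "U (- t) (U t y) = y" for y using inv[of t] inv[of "- t"] by simp_all
  have bU: "bounded_linear (U s)" for s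
    by (rule bounded_linear_intro[of _ 1])
      (simp_all add: addU normU scaleR_scaleC scaleU)
  have adjU: "adjoint_on ?M (U s) (U (- s))" for s
  proof -
    have "adjoint_on ?M (T s) (\<lambda>y. cnj (\<i> * complex_of_real s) *\<^sub>C tp x x y)"
      unfolding T_def[abs_def] by (rule adjoint_on_scaleC[OF M(4,5)])
    also have "(\<lambda>y. cnj (\<i> * complex_of_real s) *\<^sub>C tp x x y) = T (- s)"
      by (simp add: T_def fun_eq_iff)
    finally show ?thesis unfolding U by (intro adjoint_on_op_exp M bT)
  qed
  \<comment> \<open>The operators \<open>h \<alpha>\<close> are self-adjoint and commute; both \<open>A c\<close> and \<open>A (c + \<pi>/2)\<close>
      have this form, with \<open>\<alpha> = cis c / 2\<close> and with \<open>\<i> \<alpha>\<close>.\<close>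
  define h where "h \<alpha> z = \<alpha> *\<^sub>C U t z + cnj \<alpha> *\<^sub>C U (- t) z" for \<alpha> z
  have hh: "h \<alpha> (h \<beta> z) = (\<alpha> * \<beta>) *\<^sub>C U t (U t z) + (\<alpha> * cnj \<beta> + cnj \<alpha> * \<beta>) *\<^sub>C z
      + (cnj \<alpha> * cnj \<beta>) *\<^sub>C U (- t) (U (- t) z)" for \<alpha> \<beta> z
    by (simp add: h_def addU scaleU UV scaleC_add_right scaleC_add_left algebra_simps)
  have adjh: "adjoint_on ?M (h \<alpha>) (h \<alpha>)" for \<alpha>
  proof -
    have "adjoint_on ?M (h \<alpha>) (\<lambda>z. cnj \<alpha> *\<^sub>C U (- t) z + cnj (cnj \<alpha>) *\<^sub>C U (- (- t)) z)"
      unfolding h_def[abs_def] by (intro adjoint_on_add[OF M(1)] adjoint_on_scaleC[OF M(4)] adjU)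
    also have "(\<lambda>z. cnj \<alpha> *\<^sub>C U (- t) z + cnj (cnj \<alpha>) *\<^sub>C U (- (- t)) z) = h \<alpha>"
      by (simp add: h_def fun_eq_iff add.commute)
    finally show ?thesis .
  qed
  define P where "P = Blinfun (\<lambda>z. (1/2) *\<^sub>R (U t z + U (- t) z))"
  define Q where "Q = Blinfun (\<lambda>z. (1/2) *\<^sub>R (\<i> *\<^sub>C (U t z - U (- t) z)))"
  define A where "A c = cos c *\<^sub>R P + sin c *\<^sub>R Q" for c
  have P: "blinfun_apply P z = (1/2) *\<^sub>R (U t z + U (- t) z)" for z
    unfolding P_def
    by (subst bounded_linear_Blinfun_apply)
      (intro bounded_linear_compose[OF bounded_linear_scaleR_right] bounded_linear_add bU, rule refl)
  have Q: "blinfun_apply Q z = (1/2) *\<^sub>R (\<i> *\<^sub>C (U t z - U (- t) z))" for z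
    unfolding Q_def
    by (subst bounded_linear_Blinfun_apply)
      (intro bounded_linear_compose[OF bounded_linear_scaleR_right]
        bounded_linear_compose[OF bounded_linear_scaleC] bounded_linear_sub bU, rule refl)
  have A: "blinfun_apply (A c) = h (cis c / 2)" for c
  proof
    fix z
    have "cis c / 2 = complex_of_real (cos c / 2) + \<i> * complex_of_real (sin c / 2)"
      "cnj (cis c / 2) = complex_of_real (cos c / 2) - \<i> * complex_of_real (sin c / 2)"
      by (simp_all add: complex_eq_iff)
    then show "blinfun_apply (A c) z = h (cis c / 2) z"
      by (simp only: A_def blinfun.bilinear_simps P Q h_def scaleR_scaleC)
         (simp add: scaleC_add_right scaleC_add_left cvs.scale_left_diff_distrib cvs.scale_right_diff_distrib mult.commute algebra_simps)
  qed
  have normA: "norm (A c) \<le> 1" for c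
  proof (rule norm_blinfun_bound)
    fix z
    have "norm (h (cis c / 2) z) \<le> norm ((cis c / 2) *\<^sub>C U t z) + norm (cnj (cis c / 2) *\<^sub>C U (- t) z)"
      unfolding h_def by (rule norm_triangle_ineq)
    then show "norm (blinfun_apply (A c) z) \<le> 1 * norm z"
      by (simp add: A norm_scaleC normU norm_divide)
  qed simp
  have shift: "cis (c + pi/2) / 2 = \<i> * (cis c / 2)" for c by (simp add: cis_mult[symmetric])
  have "\<exists>c. blinfun_apply (A c) x = 0"
    unfolding A_def
  proof (rule common_zero_of_rotation; fold A_def)
    fix c
    show "norm (A c) \<le> 1" by (rule normA)
    define C where "C = A c o\<^sub>L A c"
    define R where "R = sqrt_id_minus C"
    define S where "S = A (c + pi/2)"
    have C1: "norm C \<le> 1"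
      unfolding C_def using norm_blinfun_compose[of "A c" "A c"] mult_mono[OF normA normA, of c c] by simp
    have "S o\<^sub>L C = C o\<^sub>L S"
    proof (rule blinfun_eqI)
      fix z
      have "h \<alpha> (h \<beta> y) = h \<beta> (h \<alpha> y)" for \<alpha> \<beta> y by (simp add: hh mult.commute add.commute)
      then show "blinfun_apply (S o\<^sub>L C) z = blinfun_apply (C o\<^sub>L S) z"
        by (simp add: S_def C_def A)
    qed
    then have RS: "blinfun_apply S (blinfun_apply R z) = blinfun_apply R (blinfun_apply S z)" for z
      using sqrt_id_minus_commute[OF C1] unfolding R_def by (metis blinfun_apply_blinfun_compose)
    \<comment> \<open>This is \<open>sin\<^sup>2 = 1 - cos\<^sup>2\<close>.\<close>
    have SS: "blinfun_apply S (blinfun_apply S z) = z - blinfun_apply C z" for z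
    proof -
      have "4 * ((cis c / 2) * cnj (cis c / 2)) = 1" by (simp add: cis_cnj cis_mult)
      then have "(\<i> * (cis c / 2)) * cnj (\<i> * (cis c / 2)) + cnj (\<i> * (cis c / 2)) * (\<i> * (cis c / 2))
        + ((cis c / 2) * cnj (cis c / 2) + cnj (cis c / 2) * (cis c / 2)) = 1"
        by (simp add: algebra_simps)
      then have "h (\<i> * (cis c / 2)) (h (\<i> * (cis c / 2)) z) + h (cis c / 2) (h (cis c / 2) z) = 1 *\<^sub>C z"
        unfolding hh by (simp add: algebra_simps flip: scaleC_add_left)
      then show ?thesis by (simp add: S_def C_def A shift eq_diff_eq)
    qed
    have RR: "blinfun_apply R (blinfun_apply R z) = z - blinfun_apply C z" for z
      using sqrt_id_minus_square[OF C1] unfolding R_def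
      by (metis blinfun_apply_blinfun_compose blinfun_apply_id_blinfun blinfun.diff_left id_apply)
    have adjR: "adjoint_on ?M (blinfun_apply R) (blinfun_apply R)"
      unfolding R_def
    proof (rule adjoint_on_sqrt[OF M(1,2) C1])
      show "adjoint_on ?M (blinfun_apply C) (blinfun_apply C)"
        using adjoint_on_compose[OF adjh adjh, of "cis c / 2" "cis c / 2"]
          by (simp add: C_def A[symmetric] o_def blinfun_compose.rep_eq)
    qed
    have adjS: "adjoint_on ?M (blinfun_apply S) (blinfun_apply S)" by (simp add: S_def A adjh)
    have adj: "adjoint_on ?M (\<lambda>z. blinfun_apply R z + blinfun_apply S z) (\<lambda>z. blinfun_apply R z + blinfun_apply S z)"
      by (rule adjoint_on_add[OF M(1) adjR adjS])
    define u where "u = blinfun_apply R x - blinfun_apply S x"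
    have "blinfun_apply R u + blinfun_apply S u = 0"
      by (simp add: u_def blinfun.bilinear_simps RS RR SS)
    moreover have "u \<in> ?M"
      using adjR adjS M(3) unfolding u_def adjoint_on_def by (intro subspace_diff M) auto
    ultimately have "tp (blinfun_apply R x + blinfun_apply S x) u z = 0" for z
      using adj M(3) by (simp add: adjoint_on_def tp_zero)
    from prime[OF this]
    show "(sqrt_id_minus (A c o\<^sub>L A c) + A (c + pi/2)) x = 0 \<or> (sqrt_id_minus (A c o\<^sub>L A c) - A (c + pi/2)) x = 0"
      by (simp add: R_def S_def C_def u_def blinfun.bilinear_simps)
  qed
  then obtain c where "blinfun_apply (A c) x = 0" by blast
  then have "(1/2) *\<^sub>R (cos c *\<^sub>R (U t x + U (- t) x) + sin c *\<^sub>R (\<i> *\<^sub>C (U t x - U (- t) x))) = 0"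
    by (simp add: A_def blinfun.bilinear_simps P Q scaleR_add_right mult.commute)
  then show ?thesis by (metis scaleR_eq_0_iff divide_eq_0_iff zero_neq_one zero_neq_numeral)
qed

text \<open>
  As \<open>exp (itL(x,x)) x = x + itL(x,x) x + O(t\<^sup>2)\<close>, the previous lemma gives
  \<open>cos c x - t sin c {x,x,x} = O(t\<^sup>2)\<close>.
\<close>

lemma cube_real_multiple:
  assumes "x \<noteq> 0"
  shows "\<exists>\<kappa>. tp x x x = \<kappa> *\<^sub>R x"
proof -
  define T where "T y = \<i> *\<^sub>C tp x x y" for y
  have bT: "bounded_linear T"
    unfolding T_def[abs_def]
      by (rule bounded_linear_compose[OF bounded_linear_scaleC bounded_linear_tp_self])
  define U where "U s = op_exp (\<lambda>y. s *\<^sub>R T y)" for s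
  have U: "U s = op_exp (\<lambda>y. (\<i> * complex_of_real s) *\<^sub>C tp x x y)" for s
    by (simp add: U_def T_def scaleR_scaleC mult.commute)
  obtain C where C: "C \<ge> 0" "\<And>s. \<bar>s\<bar> \<le> 1 \<Longrightarrow> norm (U s x - x - s *\<^sub>R T x) \<le> C * s\<^sup>2"
    using op_exp_first_order[OF bT, of x] unfolding U_def by metis
  show ?thesis
  proof (rule eigenvector_from_approximation[OF assms, where K = "2 * C"])
    fix t :: real assume t: "0 < t" "t \<le> 1"
    obtain c where c: "cos c *\<^sub>R (U t x + U (- t) x) + sin c *\<^sub>R (\<i> *\<^sub>C (U t x - U (- t) x)) = 0"
      using exp_rotation_has_zero[of t x] unfolding U by blast
    define r s where "r = U t x - x - t *\<^sub>R T x" and "s = U (- t) x - x - (- t) *\<^sub>R T x"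
    have rs: "norm r \<le> C * t\<^sup>2" "norm s \<le> C * t\<^sup>2"
      using C(2)[of t] C(2)[of "- t"] t by (simp_all add: r_def s_def)
    have sum: "U t x + U (- t) x = 2 *\<^sub>R x + (r + s)" by (simp add: r_def s_def scaleR_2)
    have diff: "U t x - U (- t) x = (2 * t) *\<^sub>R T x + (r - s)"
    proof -
      have "(2 * t) *\<^sub>R T x = t *\<^sub>R T x + t *\<^sub>R T x" by (metis mult_2 scaleR_left_distrib)
      then show ?thesis by (simp add: r_def s_def)
    qed
    have rot: "\<i> *\<^sub>C ((2 * t) *\<^sub>R T x) = - ((2 * t) *\<^sub>R tp x x x)"
    proof -
      have "\<i> * (complex_of_real (2 * t) * \<i>) = - complex_of_real (2 * t)"
        by (simp add: complex_eq_iff)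
      then show ?thesis by (simp only: T_def scaleR_scaleC cvs.scale_scale cvs.scale_minus_left)
    qed
    have "2 *\<^sub>R (cos c *\<^sub>R x - (t * sin c) *\<^sub>R tp x x x) = - (cos c *\<^sub>R (r + s) + sin c *\<^sub>R (\<i> *\<^sub>C (r - s)))"
    proof -
      define w where "w = \<i> *\<^sub>C (r - s)"
      have "cos c *\<^sub>R (2 *\<^sub>R x + (r + s)) + sin c *\<^sub>R (- ((2 * t) *\<^sub>R tp x x x) + w) = 0"
        using c unfolding sum diff scaleC_add_right rot w_def .
      then show ?thesis
        unfolding w_def[symmetric] by (simp add: eq_neg_iff_add_eq_0 algebra_simps)
    qed
    then have "2 * norm (cos c *\<^sub>R x - (t * sin c) *\<^sub>R tp x x x) = norm (cos c *\<^sub>R (r + s) + sin c *\<^sub>R (\<i> *\<^sub>C (r - s)))"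
      by (metis abs_numeral norm_minus_cancel norm_scaleR)
    also have "\<dots> \<le> norm (cos c *\<^sub>R (r + s)) + norm (sin c *\<^sub>R (\<i> *\<^sub>C (r - s)))"
      by (rule norm_triangle_ineq)
    also have "\<dots> = \<bar>cos c\<bar> * norm (r + s) + \<bar>sin c\<bar> * norm (r - s)" by (simp add: norm_scaleC)
    also have "\<dots> \<le> 1 * (norm r + norm s) + 1 * (norm r + norm s)"
      by (intro add_mono mult_mono norm_triangle_ineq norm_triangle_ineq4 abs_cos_le_one abs_sin_le_one) auto
    finally show "\<exists>c. norm (cos c *\<^sub>R x - (t * sin c) *\<^sub>R tp x x x) \<le> 2 * C * t\<^sup>2"
      using rs by (intro exI[of _ c]) simp
  qed
qed

lemma cube_eq_norm_square: "tp x x x = (norm x)\<^sup>2 *\<^sub>R x"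
proof (cases "x = 0")
  case True
  then show ?thesis by (simp add: tp_zero)
next
  case False
  obtain \<kappa> where \<kappa>: "tp x x x = \<kappa> *\<^sub>R x" using cube_real_multiple[OF False] by blast
  \<comment> \<open>The eigenvalue is non-negative, because it belongs to the spectrum.\<close>
  have "complex_of_real \<kappa> \<in> op_spectrum (tp x x)"
    unfolding op_spectrum_def
  proof (intro CollectI notI, elim exE conjE)
    fix S assume S: "bounded_clinear S" and "\<forall>y. S (tp x x y - complex_of_real \<kappa> *\<^sub>C y) = y"
    then have "S 0 = x" by (metis \<kappa> diff_self scaleR_scaleC)
    moreover have "S 0 = 0"
      using S by (simp add: bounded_clinear_def bounded_linear.linear linear_0)
    ultimately show False using False by simp
  qed
  then have "\<kappa> \<ge> 0" using spectrum_nonneg[of x] by auto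
  moreover have "norm (\<kappa> *\<^sub>R x) = norm x ^ 3" using norm_cube[of x] \<kappa> by simp
  ultimately have "\<kappa> * norm x = (norm x)\<^sup>2 * norm x" by (simp add: power2_eq_square power3_eq_cube)
  then have "\<kappa> = (norm x)\<^sup>2" using False by simp
  with \<kappa> show ?thesis by simp
qed

sublocale cubic_jb_star_triple tp
  by unfold_locales (rule cube_eq_norm_square)

end

text \<open>
  Two nonzero orthogonal elements are distinct, and would form an orthogonal set with two
  elements.
\<close>

lemma (in jb_star_triple) rank_one_imp_prime:
  assumes rank: "triple_rank_one tp" and ab: "\<And>z. tp a b z = 0"
  shows "a = 0 \<or> b = 0"
proof (rule ccontr)
  assume "\<not> (a = 0 \<or> b = 0)"
  then have ne: "a \<noteq> 0" "b \<noteq> 0" by auto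
  have "a \<noteq> b" using ab[of a] norm_cube[of a] ne by auto
  have "orthogonal_subset tp {a, b}"
    using ne ab tp_swap_eq_0[OF ab]
      by (auto simp: orthogonal_subset_def triple_orthogonal_def fun_eq_iff)
  then have "|{a, b}| \<le>o |{0 :: 'e}|"
    using rank by (simp add: triple_rank_one_def is_triple_rank_def)
  then obtain f where "inj_on f {a, b}" "f ` {a, b} \<subseteq> {0 :: 'e}"
    unfolding card_of_ordLeq[symmetric] by blast
  with \<open>a \<noteq> b\<close> show False by (auto simp: inj_on_def)
qed

section \<open>Hilbert spaces and rank one triples\<close>

theorem proposition4p15:
  shows "mazur_ulam_property TYPE('h::{real_inner, banach}) TYPE('y::banach) \<and>
    mazur_ulam_property TYPE('k::complex_hilbert) TYPE('y) \<and>
    (\<forall>tp :: 'e::complex_banach \<Rightarrow> 'e \<Rightarrow> 'e \<Rightarrow> 'e.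
      jbw_star_triple tp TYPE('p::complex_banach) \<and> triple_rank_one tp \<longrightarrow>
      mazur_ulam_property TYPE('e) TYPE('y))"
proof (intro conjI allI impI)
  show "mazur_ulam_property TYPE('h) TYPE('y)"
    by (rule parallelogram_imp_mazur_ulam) (rule real_inner_parallelogram)
  show "mazur_ulam_property TYPE('k) TYPE('y)"
    by (rule parallelogram_imp_mazur_ulam) (rule cinner_parallelogram)
  fix tp :: "'e \<Rightarrow> 'e \<Rightarrow> 'e \<Rightarrow> 'e"
  assume *: "jbw_star_triple tp TYPE('p) \<and> triple_rank_one tp"
  then interpret jb_star_triple tp by (simp add: jbw_star_triple_def)
  interpret prime_jb_star_triple tp
    by unfold_locales (rule rank_one_imp_prime, use * in auto)
  show "mazur_ulam_property TYPE('e) TYPE('y)"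
    by (rule parallelogram_imp_mazur_ulam) (rule parallelogram)
qed

end
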